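(* Assume the following. (1) (Local Lipschitz) For each $R>0$ there is $C_R>0$ such that $|f(x)-f(y)|+|g(x)-g(y)|\le C_R|x-y|$ for all $x,y\in\mathbb{R}^d$ with $|x|\vee|y|\le R$. (2) There exist constants $p\ge2$ and $\nu>0$ such that $\langle x,f(x)\rangle+\frac{p-1}{2}|g(x)|^2\le-\nu|x|^2$ for all $x\in\mathbb{R}^d$. Let $\gamma\in(0,1/2)$. Then for every $\varepsilon\in(0,p\nu)$ there is a constant $\delta_*>0$ such that for every $\delta_{\max}\in(0,\delta_*]$ and every continuous timestep function $\delta:\mathbb{R}^d\to(0,\delta_{\max}]$ satisfying $$|f(x)|(\delta(x))^\gamma\le|x|,\qquad |g(x)|^2(\delta(x))^\gamma\le|x|^2,\qquad \forall x\in\mathbb{R}^d,$$ the continuous-time adaptive Euler--Maruyama solution $\hat Y$ built with $\delta$ satisfies $$\mathbb{E}|\hat Y(t)|^p\le|x_0|^p e^{-(p\nu-\varepsilon)t},\qquad\forall t\ge0.$$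
   Context: $(\Omega,\mathcal{F},\mathbb{P})$ is a complete probability space with a filtration $\{\mathcal{F}_t\}_{t\ge0}$ satisfying the usual conditions, and $W$ is an $m$-dimensional Brownian motion with respect to it. $f:\mathbb{R}^d\to\mathbb{R}^d$, $g:\mathbb{R}^d\to\mathbb{R}^{d\times m}$, $x_0\in\mathbb{R}^d$. $|\cdot|$ is the Euclidean norm on $\mathbb{R}^d$ and the Frobenius norm on $\mathbb{R}^{d\times m}$; $a\vee b=\max\{a,b\}$. Adaptive time-stepping Euler--Maruyama scheme with timestep function $\delta$: $t_0=0$, $Y_{t_0}=x_0$, and for $n\ge0$, $\delta_n=\delta(Y_{t_n})$, $t_{n+1}=t_n+\delta_n$, $Y_{t_{n+1}}=Y_{t_n}+f(Y_{t_n})\delta_n+g(Y_{t_n})(W(t_{n+1})-W(t_n))$. For $t\ge0$ (with $t<\sup_n t_n$) put $\underline{t}=\max\{t_n:t_n\le t\}$ and $\hat Y(t)=Y_{\underline t}+f(Y_{\underline t})(t-\underline t)+g(Y_{\underline t})(W(t)-W(\underline t))$. *)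

theory Defs
  imports "HOL-Probability.Probability"
begin

text \<open>Time is modelled by the reals; only the indices \<open>t \<ge> 0\<close> of a filtration or a process
  are meaningful, and nothing is assumed about the others.\<close>

locale usual_filtered_prob_space = prob_space M + complete_measure M
  for M :: "'w measure" +
  fixes F :: "real \<Rightarrow> 'w measure"
  assumes filtration_subalgebra: "\<And>t. 0 \<le> t \<Longrightarrow> subalgebra M (F t)"
    and filtration_mono: "\<And>s t. 0 \<le> s \<Longrightarrow> s \<le> t \<Longrightarrow> subalgebra (F t) (F s)"
    and filtration_right_continuous: "\<And>t. 0 \<le> t \<Longrightarrow> sets (F t) = (\<Inter>s\<in>{t<..}. sets (F s))"
    and filtration_null_sets: "null_sets M \<subseteq> sets (F 0)"

text \<open>The increment \<open>W t - W s\<close> has law \<open>N(0, (t - s) I)\<close>, expressed as: its components are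
  independent and each is \<open>N(0, t - s)\<close>. Note that \<^const>\<open>normal_density\<close> takes the standard
  deviation, not the variance.\<close>

locale brownian_motion = usual_filtered_prob_space M F
  for M :: "'w measure" and F :: "real \<Rightarrow> 'w measure" +
  fixes W :: "real \<Rightarrow> 'w \<Rightarrow> real ^ 'm"
  assumes adapted: "\<And>t. 0 \<le> t \<Longrightarrow> W t \<in> borel_measurable (F t)"
    and starts_at_zero: "AE \<omega> in M. W 0 \<omega> = 0"
    and continuous_paths: "AE \<omega> in M. continuous_on {0..} (\<lambda>t. W t \<omega>)"
    and increments_indep_past: "\<And>s t. 0 \<le> s \<Longrightarrow> s < t \<Longrightarrow>
      indep_set (sets (F s)) (sets (vimage_algebra (space M) (\<lambda>\<omega>. W t \<omega> - W s \<omega>) borel))"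
    and increments_indep_components: "\<And>s t. 0 \<le> s \<Longrightarrow> s < t \<Longrightarrow>
      indep_vars (\<lambda>_. borel) (\<lambda>i \<omega>. (W t \<omega> - W s \<omega>) $ i) UNIV"
    and increments_normal: "\<And>s t i. 0 \<le> s \<Longrightarrow> s < t \<Longrightarrow>
      distributed M lborel (\<lambda>\<omega>. (W t \<omega> - W s \<omega>) $ i) (normal_density 0 (sqrt (t - s)))"

text \<open>The scheme is defined path by path: \<open>w\<close> is a single path \<open>\<lambda>t. W t \<omega>\<close> of the Brownian motion,
  and the \<open>n\<close>-th element of the recursion is the pair of \<open>t\<^sub>n\<close> and the value at \<open>t\<^sub>n\<close>.\<close>

primrec aem_step ::
  "(real ^ 'd \<Rightarrow> real ^ 'd) \<Rightarrow> (real ^ 'd \<Rightarrow> real ^ 'm ^ 'd) \<Rightarrow> (real ^ 'd \<Rightarrow> real) \<Rightarrow> real ^ 'd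
    \<Rightarrow> (real \<Rightarrow> real ^ 'm) \<Rightarrow> nat \<Rightarrow> real \<times> (real ^ 'd)" where
  "aem_step f g \<delta> x\<^sub>0 w 0 = (0, x\<^sub>0)"
| "aem_step f g \<delta> x\<^sub>0 w (Suc n) =
    (let (t, y) = aem_step f g \<delta> x\<^sub>0 w n; t' = t + \<delta> y
     in (t', y + \<delta> y *\<^sub>R f y + g y *v (w t' - w t)))"

definition aem_time ::
  "(real ^ 'd \<Rightarrow> real ^ 'd) \<Rightarrow> (real ^ 'd \<Rightarrow> real ^ 'm ^ 'd) \<Rightarrow> (real ^ 'd \<Rightarrow> real) \<Rightarrow> real ^ 'd
    \<Rightarrow> (real \<Rightarrow> real ^ 'm) \<Rightarrow> nat \<Rightarrow> real" where
  "aem_time f g \<delta> x\<^sub>0 w n = fst (aem_step f g \<delta> x\<^sub>0 w n)"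

definition aem_value ::
  "(real ^ 'd \<Rightarrow> real ^ 'd) \<Rightarrow> (real ^ 'd \<Rightarrow> real ^ 'm ^ 'd) \<Rightarrow> (real ^ 'd \<Rightarrow> real) \<Rightarrow> real ^ 'd
    \<Rightarrow> (real \<Rightarrow> real ^ 'm) \<Rightarrow> nat \<Rightarrow> real ^ 'd" where
  "aem_value f g \<delta> x\<^sub>0 w n = snd (aem_step f g \<delta> x\<^sub>0 w n)"

text \<open>For positive \<open>\<delta>\<close> the grid \<open>t\<^sub>n\<close> is strictly increasing, so the largest grid point below \<open>t\<close> is
  the one with the largest index. If \<open>t \<ge> sup t\<^sub>n\<close> the set of indices is infinite, the maximum is
  unspecified, and the value of \<open>aem_solution\<close> carries no meaning.\<close>

definition aem_solution ::
  "(real ^ 'd \<Rightarrow> real ^ 'd) \<Rightarrow> (real ^ 'd \<Rightarrow> real ^ 'm ^ 'd) \<Rightarrow> (real ^ 'd \<Rightarrow> real) \<Rightarrow> real ^ 'd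
    \<Rightarrow> (real \<Rightarrow> real ^ 'm) \<Rightarrow> real \<Rightarrow> real ^ 'd" where
  "aem_solution f g \<delta> x\<^sub>0 w t =
    (let n = Max {n. aem_time f g \<delta> x\<^sub>0 w n \<le> t};
         s = aem_time f g \<delta> x\<^sub>0 w n;
         y = aem_value f g \<delta> x\<^sub>0 w n
     in y + (t - s) *\<^sub>R f y + g y *v (w t - w s))"

end

theory Submission
  imports Defs
begin

text \<open>
The proof uses no stochastic calculus; it analyses a single step of the scheme and iterates.

Let \<open>\<kappa> = p * \<nu> - \<epsilon>\<close>. For a step of deterministic length \<open>h \<le> \<delta> y\<close> from a deterministic point
\<open>y\<close>, with a Gaussian increment of variance \<open>h\<close>, lemma \<open>normal_step_contraction\<close> shows that the
expected \<open>p\<close>-th power of the norm shrinks by the factor \<open>exp (- \<kappa> * h)\<close>. Relative to the size of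
\<open>y\<close>, the conditions on \<open>\<delta>\<close> make the drift of size \<open>h powr (1 - \<gamma>)\<close> and the noise of size
\<open>h powr ((1 - \<gamma>) / 2)\<close>. As the noise is symmetric, all terms of odd degree in it average out,
and dissipativity controls what remains up to an error of order \<open>h powr (2 - 2 * \<gamma>)\<close>. This is
\<open>o(h)\<close> precisely because \<open>\<gamma> < 1/2\<close>, so the error is absorbed by \<open>\<epsilon> * h\<close> once the steps are
small.

Since the grid points are random, the step has to be transferred to stopping times. Lemma
\<open>nn_integral_moment_Suc\<close> does so by rounding the starting time up and the length down to a grid
of mesh tending to zero, and by Fatou's lemma. It follows that
\<open>exp (\<kappa> * t\<^sub>n) * norm (Y\<^sub>n) powr p\<close> has expectation at most \<open>norm x\<^sub>0 powr p\<close>, and this is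
proved for every rule that makes steps of length at most \<open>\<delta>\<close>, including zero.

Two such rules finish the proof. The rule that stops at time \<open>t\<close> and on leaving a ball of radius
\<open>R\<close> shows that the grid fails to pass \<open>t\<close> with probability at most \<open>(norm x\<^sub>0 / R) powr p\<close>, for
every \<open>R\<close>; hence the grid passes \<open>t\<close> almost surely (\<open>AE_aem_time_unbounded\<close>). The rule that
stops at time \<open>t\<close> only gives a chain that almost surely ends in the solution at time \<open>t\<close>, and
the bound follows once more from Fatou's lemma (\<open>aem_solution_moment\<close>).\<close>

section \<open>Symmetrised Taylor expansion of real powers\<close>

lemma powr_le_two_powr_abs:
  fixes x e :: real
  assumes "1/2 \<le> x" "x \<le> 2"
  shows "x powr e \<le> 2 powr \<bar>e\<bar>"
proof -
  have "- ln 2 \<le> ln x" using assms(1) ln_le_cancel_iff[of "1/2" x] by (simp add: ln_div)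
  moreover have "ln x \<le> ln 2" using assms by simp
  ultimately have "\<bar>ln x\<bar> \<le> ln 2" by linarith
  then have "e * ln x \<le> \<bar>e\<bar> * ln 2"
    by (metis abs_ge_self abs_mult mult_left_mono abs_ge_zero order_trans)
  then show ?thesis using assms by (simp add: powr_def)
qed

text \<open>The third order term has to be kept exactly. After averaging over \<open>\<plusminus>\<close> the noise its leading part
vanishes, whereas a remainder of order three would leave a one-step error
\<open>h powr (3 * (1 - \<gamma>) / 2)\<close>, which is \<open>o(h)\<close> only for \<open>\<gamma> < 1/3\<close>.\<close>

lemma powr_Taylor_cubic_near:
  fixes q z :: real
  assumes "\<bar>z\<bar> \<le> 1/2"
  shows "(1 + z) powr q \<le> 1 + q * z + q * (q - 1) / 2 * z^2 + q * (q - 1) * (q - 2) / 6 * z^3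
    + \<bar>q * (q - 1) * (q - 2) * (q - 3)\<bar> * 2 powr \<bar>q - 4\<bar> * z^4"
proof (cases "z = 0")
  case False
  define D :: "nat \<Rightarrow> real \<Rightarrow> real" where
    "D m t = (\<Prod>i<m. q - real i) * (1 + t) powr (q - real m)" for m t
  have "\<exists>t. (if z < 0 then z < t \<and> t < 0 else 0 < t \<and> t < z) \<and>
      (1 + z) powr q = (\<Sum>m<4. D m 0 / fact m * (z - 0)^m) + D 4 t / fact 4 * (z - 0)^4"
  proof (rule Taylor[where a = "-1/2" and b = "1/2"])
    show "D 0 = (\<lambda>x. (1 + x) powr q)" by (rule ext) (simp add: D_def)
    show "\<forall>m t. m < 4 \<and> -1/2 \<le> t \<and> t \<le> 1/2 \<longrightarrow> (D m has_real_derivative D (Suc m) t) (at t)"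
      unfolding D_def by (auto intro!: derivative_eq_intros simp: algebra_simps)
  qed (use assms False in auto)
  then obtain t where "if z < 0 then z < t \<and> t < 0 else 0 < t \<and> t < z"
    and "(1 + z) powr q = (\<Sum>m<4. D m 0 / fact m * (z - 0)^m) + D 4 t / fact 4 * (z - 0)^4"
    by blast
  then have t: "\<bar>t\<bar> \<le> 1/2"
    and eq: "(1 + z) powr q = (\<Sum>m<4. D m 0 / fact m * z^m) + D 4 t / fact 4 * z^4"
    using assms by (simp_all split: if_splits)
  have "(\<Sum>m<4. D m 0 / fact m * z^m)
      = 1 + q * z + q * (q - 1) / 2 * z^2 + q * (q - 1) * (q - 2) / 6 * z^3"
    by (simp add: D_def numeral_eq_Suc fact_numeral)
  moreover have "D 4 t / fact 4 * z^4
      \<le> \<bar>q * (q - 1) * (q - 2) * (q - 3)\<bar> * 2 powr \<bar>q - 4\<bar> * z^4"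
  proof (rule mult_right_mono)
    have "D 4 t = (q * (q - 1) * (q - 2) * (q - 3)) * (1 + t) powr (q - 4)"
      by (simp add: D_def numeral_eq_Suc)
    also have "\<dots> \<le> \<bar>q * (q - 1) * (q - 2) * (q - 3)\<bar> * 2 powr \<bar>q - 4\<bar>"
      using t by (intro mult_mono powr_le_two_powr_abs) auto
    finally have "D 4 t \<le> \<bar>q * (q - 1) * (q - 2) * (q - 3)\<bar> * 2 powr \<bar>q - 4\<bar>" .
    moreover have "0 \<le> \<bar>q * (q - 1) * (q - 2) * (q - 3)\<bar> * 2 powr \<bar>q - 4\<bar>" by simp
    ultimately have "D 4 t \<le> \<bar>q * (q - 1) * (q - 2) * (q - 3)\<bar> * 2 powr \<bar>q - 4\<bar> * fact 4"
      using mult_left_mono[OF fact_ge_1, of "\<bar>q * (q - 1) * (q - 2) * (q - 3)\<bar> * 2 powr \<bar>q - 4\<bar>" 4]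
      by linarith
    then show "D 4 t / fact 4 \<le> \<bar>q * (q - 1) * (q - 2) * (q - 3)\<bar> * 2 powr \<bar>q - 4\<bar>"
      by (simp only: pos_divide_le_eq[OF fact_gt_zero])
  qed simp
  ultimately show ?thesis using eq by linarith
qed simp

text \<open>The factor \<open>(1 + \<bar>z\<bar>)^N\<close> makes the expansion global, as is needed for a Gaussian, hence
unbounded, \<open>z\<close>. Away from the origin every term is dominated by the remainder because
\<open>1 \<le> 16 * z^4\<close> there.\<close>

lemma powr_Taylor_cubic:
  fixes q :: real
  assumes "1 \<le> q"
  obtains C and N :: nat where "0 \<le> C"
    and "\<And>z. - 1 \<le> z \<Longrightarrow> (1 + z) powr q \<le> 1 + q * z + q * (q - 1) / 2 * z^2
      + q * (q - 1) * (q - 2) / 6 * z^3 + C * z^4 * (1 + \<bar>z\<bar>)^N"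
proof -
  define c1 where "c1 = q * (q - 1) / 2"
  define c2 where "c2 = q * (q - 1) * (q - 2) / 6"
  define C1 where "C1 = \<bar>q * (q - 1) * (q - 2) * (q - 3)\<bar> * 2 powr \<bar>q - 4\<bar>"
  define B where "B = 2 + \<bar>q\<bar> + \<bar>c1\<bar> + \<bar>c2\<bar>"
  define N where "N = nat \<lceil>q\<rceil> + 3"
  have C1: "0 \<le> C1" and B: "0 \<le> B" by (simp_all add: C1_def B_def)
  have bound: "(1 + z) powr q \<le> 1 + q * z + c1 * z^2 + c2 * z^3 + (C1 + 16 * B) * z^4 * (1 + \<bar>z\<bar>)^N"
    if z: "- 1 \<le> z" for z
  proof (cases "\<bar>z\<bar> \<le> 1/2")
    case True
    have "(1 + z) powr q \<le> 1 + q * z + c1 * z^2 + c2 * z^3 + C1 * z^4"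
      using powr_Taylor_cubic_near[OF True, of q] by (simp add: c1_def c2_def C1_def)
    moreover have "C1 * z^4 * 1 \<le> (C1 + 16 * B) * z^4 * (1 + \<bar>z\<bar>)^N"
      using C1 B by (intro mult_mono mult_right_mono) auto
    ultimately show ?thesis by linarith
  next
    case False
    let ?X = "1 + \<bar>z\<bar>"
    have X: "1 \<le> ?X" by simp
    have XN: "?X^j \<le> ?X^N" if "j \<le> N" for j using that X by (rule power_increasing)
    have "(1 + z) powr q \<le> ?X powr q" using z assms by (intro powr_mono2) auto
    also have "\<dots> \<le> ?X powr (real N)"
      using X assms by (intro powr_mono) (auto simp: N_def, linarith)
    also have "\<dots> = ?X^N" by (simp add: powr_realpow)
    finally have p: "(1 + z) powr q \<le> ?X^N" .
    have zi: "\<bar>z\<bar>^j \<le> ?X^N" if "j \<le> N" for j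
      using power_mono[of "\<bar>z\<bar>" ?X j] XN[OF that] by simp
    have "\<bar>c * z^j\<bar> \<le> \<bar>c\<bar> * ?X^N" if "j \<le> N" for c j
      using zi[OF that] by (simp add: abs_mult power_abs mult_left_mono)
    from this[of 0 1] this[of 1 q] this[of 2 c1] this[of 3 c2]
    have "- 1 \<le> ?X^N" "- (q * z) \<le> \<bar>q\<bar> * ?X^N"
      "- (c1 * z^2) \<le> \<bar>c1\<bar> * ?X^N" "- (c2 * z^3) \<le> \<bar>c2\<bar> * ?X^N"
      using order_trans[OF _ zero_le_power[of ?X N]] by (simp_all add: N_def abs_le_iff)
    then have "(1 + z) powr q - (1 + q * z + c1 * z^2 + c2 * z^3)
        \<le> ?X^N + (?X^N + \<bar>q\<bar> * ?X^N + \<bar>c1\<bar> * ?X^N + \<bar>c2\<bar> * ?X^N)"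
      using p by linarith
    also have "\<dots> = B * ?X^N" by (simp add: B_def algebra_simps)
    also have "\<dots> \<le> (C1 + 16 * B) * z^4 * ?X^N"
    proof (rule mult_right_mono)
      have "(1/2)^4 \<le> \<bar>z\<bar>^4" using False by (intro power_mono) auto
      then have "1 \<le> 16 * z^4" by (simp add: power_divide)
      then have "B * 1 \<le> B * (16 * z^4)" using B by (intro mult_left_mono)
      moreover have "0 \<le> C1 * z^4" using C1 by simp
      ultimately show "B \<le> (C1 + 16 * B) * z^4" by (simp add: algebra_simps)
    qed simp
    finally show ?thesis by simp
  qed
  show ?thesis
    by (rule that[of "C1 + 16 * B" N]) (use C1 B bound in \<open>simp_all add: c1_def c2_def\<close>)
qed

text \<open>Read \<open>1 + a + \<rho> \<plusminus> b\<close> as \<open>\<bar>u \<plusminus> w\<bar>\<^sup>2\<close>, normalised by the square of the norm of the starting point: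
\<open>u\<close> is the point after the drift step, \<open>w\<close> the noise, \<open>\<rho> = \<bar>w\<bar>\<^sup>2\<close>, and \<open>b\<close> twice the inner
product of \<open>u\<close> and \<open>w\<close>. In the average over the sign only even powers of \<open>b\<close> survive. The only
one of first order in \<open>\<eta>\<close> is \<open>b\<^sup>2\<close>, and Cauchy--Schwarz turns it into a multiple of \<open>\<rho>\<close>: the
coefficient \<open>q + 2 * q * (q - 1) = q * (2 * q - 1)\<close> is, for \<open>p = 2 * q\<close>, exactly \<open>p\<close> times the
\<open>(p - 1) / 2\<close> of the dissipativity condition. All other terms are of order \<open>\<eta>\<^sup>2\<close>.\<close>

lemma powr_symmetric_average:
  fixes q :: real
  assumes q: "1 \<le> q"
  obtains K and N :: nat where "0 \<le> K"
    and "\<And>\<eta> \<zeta> a \<rho> b. \<lbrakk>0 \<le> \<eta>; \<eta> \<le> 1; 0 \<le> \<zeta>; \<bar>a\<bar> \<le> 3 * \<eta>; - 1 \<le> a; 0 \<le> \<rho>; \<rho> \<le> \<eta> * \<zeta>\<^sup>2;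
        b\<^sup>2 \<le> 4 * (1 + a) * \<rho>\<rbrakk> \<Longrightarrow>
      ((1 + a + \<rho> + b) powr q + (1 + a + \<rho> - b) powr q) / 2
        \<le> 1 + q * a + q * (2 * q - 1) * \<rho> + K * \<eta>\<^sup>2 * (1 + \<zeta>)^N"
proof -
  obtain C N where C: "0 \<le> C"
    and T: "\<And>z. - 1 \<le> z \<Longrightarrow> (1 + z) powr q \<le> 1 + q * z + q * (q - 1) / 2 * z^2
      + q * (q - 1) * (q - 2) / 6 * z^3 + C * z^4 * (1 + \<bar>z\<bar>)^N"
    using powr_Taylor_cubic[OF q] by blast
  define c1 where "c1 = q * (q - 1) / 2"
  define c2 where "c2 = q * (q - 1) * (q - 2) / 6"
  have c1: "0 \<le> c1" using q by (simp add: c1_def)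
  \<comment> \<open>21 = 9 + 12 comes from the bounds for \<open>c\<^sup>2\<close> and \<open>b\<^sup>2\<close>, 171 = 27 + 3 * 48 from those for \<open>c^3\<close> and
    \<open>3 * c * b\<^sup>2\<close>, and \<open>7^4 * 8^N\<close> from \<open>\<bar>c \<plusminus> b\<bar> \<le> 7 * sqrt \<eta> * X\<^sup>2\<close>.\<close>
  define K where "K = 21 * c1 + \<bar>c2\<bar> * 171 + C * 7^4 * 8^N"
  have "((1 + a + \<rho> + b) powr q + (1 + a + \<rho> - b) powr q) / 2
        \<le> 1 + q * a + q * (2 * q - 1) * \<rho> + K * \<eta>\<^sup>2 * (1 + \<zeta>)^(2 * N + 8)"
    if A: "0 \<le> \<eta>" "\<eta> \<le> 1" "0 \<le> \<zeta>" "\<bar>a\<bar> \<le> 3 * \<eta>" "- 1 \<le> a" "0 \<le> \<rho>" "\<rho> \<le> \<eta> * \<zeta>\<^sup>2"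
      "b\<^sup>2 \<le> 4 * (1 + a) * \<rho>" for \<eta> \<zeta> a \<rho> b
  proof -
    define X where "X = 1 + \<zeta>"
    define c where "c = a + \<rho>"
    \<comment> \<open>\<open>P\<close> dominates every monomial of order at least two in \<open>\<eta>\<close> that occurs below.\<close>
    define P where "P = \<eta>\<^sup>2 * X^(2 * N + 8)"
    have X: "1 \<le> X" using A by (simp add: X_def)
    have Xj: "X^j \<le> X^(2 * N + 8)" if "j \<le> 2 * N + 8" for j using that X by (rule power_increasing)
    have zX: "\<zeta>\<^sup>2 \<le> X\<^sup>2" using A by (intro power_mono) (auto simp: X_def)
    have etaj: "\<eta>^j \<le> \<eta>\<^sup>2" if "2 \<le> j" for j using that A by (intro power_decreasing) auto
    have P: "\<eta>^i * X^j \<le> P" if "2 \<le> i" "j \<le> 2 * N + 8" for i j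
      unfolding P_def using Xj[OF that(2)] etaj[OF that(1)] A X by (intro mult_mono) auto
    have cb: "\<bar>c\<bar> \<le> 3 * \<eta> * X\<^sup>2"
    proof -
      have "\<bar>c\<bar> \<le> 3 * \<eta> + \<eta> * \<zeta>\<^sup>2" using A unfolding c_def by linarith
      also have "\<dots> = \<eta> * (3 + \<zeta>\<^sup>2)" by (simp add: algebra_simps)
      also have "\<dots> \<le> \<eta> * (3 * X\<^sup>2)" using A
        by (intro mult_left_mono) (auto simp: X_def power2_eq_square algebra_simps)
      finally show ?thesis by simp
    qed
    have rX: "\<rho> \<le> \<eta> * X\<^sup>2" using A zX by (meson mult_left_mono order_trans)
    have b2': "b\<^sup>2 \<le> 4 * \<rho> + 12 * P"
    proof -
      have "a * \<rho> \<le> (3 * \<eta>) * (\<eta> * X\<^sup>2)" using A rX by (intro mult_mono) auto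
      also have "\<dots> = 3 * (\<eta>^2 * X^2)" by (simp add: power2_eq_square)
      also have "\<dots> \<le> 3 * P" using P[of 2 2] by simp
      finally have "a * \<rho> \<le> 3 * P" .
      then show ?thesis using A(8) by (simp add: algebra_simps)
    qed
    have b2: "b\<^sup>2 \<le> 16 * \<eta> * X\<^sup>2"
    proof -
      have "4 * (1 + a) * \<rho> \<le> 16 * \<rho>" using A by (intro mult_right_mono) auto
      then show ?thesis using A(8) rX by linarith
    qed
    have c2b: "c\<^sup>2 \<le> 9 * P"
    proof -
      have "c\<^sup>2 \<le> (3 * \<eta> * X\<^sup>2)\<^sup>2" using cb by (metis abs_ge_zero power2_abs power_mono)
      also have "\<dots> = 9 * (\<eta>^2 * X^4)" by (simp add: power_mult_distrib flip: power_mult)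
      finally show ?thesis using P[of 2 4] by simp
    qed
    have c3b: "\<bar>c^3\<bar> \<le> 27 * P"
    proof -
      have "\<bar>c\<bar>^3 \<le> (3 * \<eta> * X\<^sup>2)^3" using cb by (intro power_mono) auto
      also have "\<dots> = 27 * (\<eta>^3 * X^6)" by (simp add: power_mult_distrib flip: power_mult)
      finally show ?thesis using P[of 3 6] by (simp add: power_abs)
    qed
    have cbb: "\<bar>c * b\<^sup>2\<bar> \<le> 48 * P"
    proof -
      have "\<bar>c\<bar> * b\<^sup>2 \<le> (3 * \<eta> * X\<^sup>2) * (16 * \<eta> * X\<^sup>2)"
        using cb b2 A X by (intro mult_mono) auto
      also have "\<dots> = 48 * (\<eta>^2 * X^4)" by (simp add: numeral_eq_Suc)
      finally show ?thesis using P[of 2 4] by (simp add: abs_mult)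
    qed
    have rem: "C * z^4 * (1 + \<bar>z\<bar>)^N \<le> C * 7^4 * 8^N * P" if z: "\<bar>z\<bar> \<le> \<bar>c\<bar> + \<bar>b\<bar>" for z
    proof -
      define e where "e = sqrt \<eta>"
      have e: "0 \<le> e" "e \<le> 1" "e\<^sup>2 = \<eta>" using A by (auto simp: e_def)
      have "\<bar>b\<bar> \<le> 4 * e * X"
      proof (rule power2_le_imp_le)
        show "\<bar>b\<bar>\<^sup>2 \<le> (4 * e * X)\<^sup>2" using b2 e by (simp add: power_mult_distrib)
      qed (use e X in auto)
      also have "\<dots> \<le> 4 * e * X\<^sup>2" using e X by (intro mult_left_mono) (auto simp: power2_eq_square)
      finally have "\<bar>b\<bar> \<le> 4 * e * X\<^sup>2" .
      moreover have "\<eta> * X\<^sup>2 \<le> e * X\<^sup>2"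
        using e by (intro mult_right_mono) (auto simp flip: e(3) simp: power2_eq_square mult_left_le)
      ultimately have z7: "\<bar>z\<bar> \<le> 7 * e * X\<^sup>2" using z cb by linarith
      have "\<bar>z\<bar>^4 \<le> (7 * e * X\<^sup>2)^4" using z7 by (intro power_mono) auto
      also have "\<dots> = 7^4 * (\<eta>\<^sup>2 * X^8)"
        by (simp add: power_mult_distrib flip: power_mult e(3))
      finally have z4: "z^4 \<le> 7^4 * (\<eta>\<^sup>2 * X^8)" by simp
      have "1 + \<bar>z\<bar> \<le> 8 * X\<^sup>2"
      proof -
        have "e * X\<^sup>2 \<le> 1 * X\<^sup>2" using e by (intro mult_right_mono) auto
        moreover have "1 \<le> X\<^sup>2" using X by simp
        ultimately show ?thesis using z7 by linarith
      qed
      then have "(1 + \<bar>z\<bar>)^N \<le> (8 * X\<^sup>2)^N" by (intro power_mono) auto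
      also have "\<dots> = 8^N * X^(2 * N)" by (simp add: power_mult_distrib flip: power_mult)
      finally have zN: "(1 + \<bar>z\<bar>)^N \<le> 8^N * X^(2 * N)" .
      have "C * z^4 * (1 + \<bar>z\<bar>)^N \<le> C * (7^4 * (\<eta>\<^sup>2 * X^8)) * (8^N * X^(2 * N))"
        using C z4 zN A X by (intro mult_mono mult_left_mono) auto
      also have "\<dots> = C * 7^4 * 8^N * P" by (simp add: P_def power_add)
      finally show ?thesis .
    qed
    have nonneg: "\<bar>b\<bar> \<le> 1 + c"
    proof (rule power2_le_imp_le)
      have "4 * (1 + a) * \<rho> \<le> (1 + a + \<rho>)\<^sup>2"
        using zero_le_power2[of "1 + a - \<rho>"] by (simp add: power2_eq_square algebra_simps)
      then show "\<bar>b\<bar>\<^sup>2 \<le> (1 + c)\<^sup>2" using A by (simp add: c_def add.assoc)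
    qed (use A in \<open>simp add: c_def\<close>)
    have T1: "(1 + (c + b)) powr q \<le> 1 + q * (c + b) + c1 * (c + b)^2 + c2 * (c + b)^3
        + C * 7^4 * 8^N * P"
      using T[of "c + b"] rem[of "c + b"] nonneg unfolding c1_def c2_def by linarith
    have T2: "(1 + (c - b)) powr q \<le> 1 + q * (c - b) + c1 * (c - b)^2 + c2 * (c - b)^3
        + C * 7^4 * 8^N * P"
      using T[of "c - b"] rem[of "c - b"] nonneg unfolding c1_def c2_def by linarith
    have "((1 + (c + b)) powr q + (1 + (c - b)) powr q) / 2
        \<le> 1 + q * c + c1 * (c\<^sup>2 + b\<^sup>2) + c2 * (c^3 + 3 * (c * b\<^sup>2)) + C * 7^4 * 8^N * P"
      using T1 T2 by (simp add: power2_eq_square power3_eq_cube field_simps)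
    also have "c2 * (c^3 + 3 * (c * b\<^sup>2)) \<le> \<bar>c2\<bar> * (171 * P)"
    proof -
      have "\<bar>c^3 + 3 * (c * b\<^sup>2)\<bar> \<le> 171 * P" using c3b cbb by linarith
      then have "\<bar>c2\<bar> * \<bar>c^3 + 3 * (c * b\<^sup>2)\<bar> \<le> \<bar>c2\<bar> * (171 * P)" by (rule mult_left_mono) simp
      then show ?thesis by (simp add: abs_mult[symmetric] abs_le_iff)
    qed
    also have "c1 * (c\<^sup>2 + b\<^sup>2) \<le> c1 * (9 * P + (4 * \<rho> + 12 * P))"
      using c2b b2' c1 by (intro mult_left_mono) linarith+
    also have "1 + q * c + c1 * (9 * P + (4 * \<rho> + 12 * P)) + \<bar>c2\<bar> * (171 * P) + C * 7^4 * 8^N * P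
        = 1 + q * a + q * (2 * q - 1) * \<rho> + K * P"
      by (simp add: K_def c_def c1_def field_simps)
    finally show ?thesis by (simp add: c_def P_def X_def algebra_simps)
  qed
  moreover have "0 \<le> K" using c1 C by (simp add: K_def)
  ultimately show ?thesis using that by blast
qed

section \<open>Centred normal vectors\<close>

lemma borel_measurable_vec_nth: "(\<lambda>v :: real ^ 'm. v $ i) \<in> borel_measurable borel"
  by (intro borel_measurable_continuous_onI continuous_intros)

lemma borel_measurable_vecI:
  fixes X :: "'a \<Rightarrow> real ^ 'm"
  assumes "\<And>i. (\<lambda>x. X x $ i) \<in> borel_measurable M"
  shows "X \<in> borel_measurable M"
proof (subst borel_measurable_euclidean_space, intro ballI)
  fix b :: "real ^ 'm" assume "b \<in> Basis"
  then obtain i where "b = axis i 1" by (auto simp: Basis_vec_def)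
  then show "(\<lambda>x. X x \<bullet> b) \<in> borel_measurable M"
    using assms[of i] by (simp add: inner_axis)
qed

lemma borel_measurable_matrix_vector_mult [measurable (raw)]:
  fixes A :: "'a \<Rightarrow> real ^ 'm ^ 'd" and X :: "'a \<Rightarrow> real ^ 'm"
  assumes "A \<in> borel_measurable M" "X \<in> borel_measurable M"
  shows "(\<lambda>x. A x *v X x) \<in> borel_measurable M"
proof (rule borel_measurable_vecI)
  fix i
  have "continuous_on UNIV (\<lambda>B :: real ^ 'm ^ 'd. B $ i)" by (intro continuous_intros)
  then have "(\<lambda>B :: real ^ 'm ^ 'd. B $ i) \<in> borel_measurable borel"
    by (rule borel_measurable_continuous_onI)
  from measurable_compose[OF assms(1) this] assms(2)
  show "(\<lambda>x. (A x *v X x) $ i) \<in> borel_measurable M"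
    unfolding matrix_vector_mul_component by (rule borel_measurable_inner)
qed

lemma norm_vec_power2: "(norm (x :: 'a :: real_normed_vector ^ 'n))\<^sup>2 = (\<Sum>i\<in>UNIV. (norm (x $ i))\<^sup>2)"
  by (simp add: norm_vec_def L2_set_def sum_nonneg)

lemma norm_matrix_vector_mult_le:
  fixes A :: "real ^ 'm ^ 'd" and v :: "real ^ 'm"
  shows "norm (A *v v) \<le> norm A * norm v"
proof (rule power2_le_imp_le)
  have "(norm (A *v v))\<^sup>2 = (\<Sum>i\<in>UNIV. (A $ i \<bullet> v)\<^sup>2)"
    by (simp add: norm_vec_power2[of "A *v v"] matrix_vector_mul_component)
  also have "\<dots> \<le> (\<Sum>i\<in>UNIV. (norm (A $ i))\<^sup>2 * (norm v)\<^sup>2)"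
    by (intro sum_mono) (metis Cauchy_Schwarz_ineq power2_norm_eq_inner)
  also have "\<dots> = (norm A * norm v)\<^sup>2"
    by (simp add: norm_vec_power2[of A] power_mult_distrib sum_distrib_right)
  finally show "(norm (A *v v))\<^sup>2 \<le> (norm A * norm v)\<^sup>2" .
qed simp

context prob_space begin

definition centred_normal_vec :: "real \<Rightarrow> ('a \<Rightarrow> real ^ 'm) \<Rightarrow> bool" where
  "centred_normal_vec \<sigma> X \<longleftrightarrow> indep_vars (\<lambda>_. borel) (\<lambda>i \<omega>. X \<omega> $ i) UNIV \<and>
    (\<forall>i. distributed M lborel (\<lambda>\<omega>. X \<omega> $ i) (normal_density 0 \<sigma>))"

lemma centred_normal_vec_measurable:
  assumes "centred_normal_vec \<sigma> X"
  shows "X \<in> borel_measurable M"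
  using assms by (intro borel_measurable_vecI) (auto simp: centred_normal_vec_def indep_vars_def)

text \<open>The law is the image of a product measure that depends on \<open>\<sigma>\<close> only. This yields both the
symmetry of the law and Brownian scaling.\<close>

lemma distr_centred_normal_vec_unique:
  fixes X Y :: "'a \<Rightarrow> real ^ 'm"
  assumes X: "centred_normal_vec \<sigma> X" and Y: "centred_normal_vec \<sigma> Y"
  shows "distr M borel X = distr M borel Y"
proof -
  define J :: "('m \<Rightarrow> real) \<Rightarrow> real ^ 'm" where "J x = (\<chi> i. x i)" for x
  have J: "J \<in> borel_measurable (Pi\<^sub>M UNIV (\<lambda>_. borel))"
    by (intro borel_measurable_vecI) (simp add: J_def)
  have *: "distr M borel U
      = distr (Pi\<^sub>M UNIV (\<lambda>_. density lborel (normal_density 0 \<sigma>))) borel J"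
    if U: "centred_normal_vec \<sigma> U" for U :: "'a \<Rightarrow> real ^ 'm"
  proof -
    have rv: "(\<lambda>\<omega>. U \<omega> $ i) \<in> borel_measurable M" for i
      using U by (auto simp: centred_normal_vec_def indep_vars_def)
    have d: "distr M borel (\<lambda>\<omega>. U \<omega> $ i) = density lborel (normal_density 0 \<sigma>)" for i
    proof -
      have "distr M lborel (\<lambda>\<omega>. U \<omega> $ i) = density lborel (normal_density 0 \<sigma>)"
        using U by (auto simp: centred_normal_vec_def intro: distributed_distr_eq_density)
      moreover have "distr M lborel (\<lambda>\<omega>. U \<omega> $ i) = distr M borel (\<lambda>\<omega>. U \<omega> $ i)"
        by (rule distr_cong) auto
      ultimately show ?thesis by simp
    qed
    have "distr M (Pi\<^sub>M UNIV (\<lambda>_. borel)) (\<lambda>\<omega>. \<lambda>i\<in>UNIV. U \<omega> $ i)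
        = Pi\<^sub>M UNIV (\<lambda>i. distr M borel (\<lambda>\<omega>. U \<omega> $ i))"
      using U rv by (subst indep_vars_iff_distr_eq_PiM[symmetric]) (auto simp: centred_normal_vec_def)
    then have "Pi\<^sub>M UNIV (\<lambda>_. density lborel (normal_density 0 \<sigma>))
        = distr M (Pi\<^sub>M UNIV (\<lambda>_. borel)) (\<lambda>\<omega>. \<lambda>i\<in>UNIV. U \<omega> $ i)"
      by (simp add: d)
    moreover have "distr (distr M (Pi\<^sub>M UNIV (\<lambda>_. borel)) (\<lambda>\<omega>. \<lambda>i\<in>UNIV. U \<omega> $ i)) borel J
        = distr M borel U"
      by (subst distr_distr[OF J]) (auto intro!: measurable_restrict rv distr_cong simp: J_def vec_eq_iff)
    ultimately show ?thesis by simp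
  qed
  from *[OF X] *[OF Y] show ?thesis by simp
qed

lemma centred_normal_vec_scaleR:
  assumes X: "centred_normal_vec \<sigma> X" and "0 < \<sigma>" "c \<noteq> 0"
  shows "centred_normal_vec (\<bar>c\<bar> * \<sigma>) (\<lambda>\<omega>. c *\<^sub>R X \<omega>)"
proof -
  have "indep_vars (\<lambda>_. borel) (\<lambda>i \<omega>. c * (X \<omega> $ i)) UNIV"
    using X unfolding centred_normal_vec_def by (intro indep_vars_compose2[where Y = "\<lambda>_ x. c * x"]) auto
  moreover have "distributed M lborel (\<lambda>\<omega>. c * (X \<omega> $ i)) (normal_density 0 (\<bar>c\<bar> * \<sigma>))" for i
    using normal_density_affine[of "\<lambda>\<omega>. X \<omega> $ i" 0 \<sigma> c 0] X assms(2,3)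
    by (simp add: centred_normal_vec_def)
  ultimately show ?thesis by (simp add: centred_normal_vec_def)
qed

text \<open>The norm is at most the dimension times the largest \<open>\<bar>Z \<omega> $ i\<bar>\<close>, so the sum of the
one-dimensional absolute moments dominates.\<close>

lemma std_normal_vec_moment_integrable:
  assumes Z: "centred_normal_vec 1 Z"
  shows "integrable M (\<lambda>\<omega>. (1 + norm (Z \<omega>)) ^ k)"
proof (rule Bochner_Integration.integrable_bound)
  let ?c = "real CARD('b) + 1"
  have rv: "(\<lambda>\<omega>. Z \<omega> $ i) \<in> borel_measurable M" for i
    using Z by (auto simp: centred_normal_vec_def indep_vars_def)
  have "integrable M (\<lambda>\<omega>. \<bar>Z \<omega> $ i\<bar> ^ k)" for i
    using integrable_std_normal_moment_abs[of k] Z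
    by (subst distributed_integrable[symmetric, where N = lborel and f = std_normal_density])
       (auto simp: centred_normal_vec_def)
  then show "integrable M (\<lambda>\<omega>. ?c ^ k * (1 + (\<Sum>i\<in>UNIV. \<bar>Z \<omega> $ i\<bar> ^ k)))"
    by auto
  show "(\<lambda>\<omega>. (1 + norm (Z \<omega>)) ^ k) \<in> borel_measurable M"
    using centred_normal_vec_measurable[OF Z] by measurable
  show "AE \<omega> in M. norm ((1 + norm (Z \<omega>)) ^ k) \<le> norm (?c ^ k * (1 + (\<Sum>i\<in>UNIV. \<bar>Z \<omega> $ i\<bar> ^ k)))"
  proof (rule AE_I2)
    fix \<omega>
    define m where "m = Max (range (\<lambda>i. \<bar>Z \<omega> $ i\<bar>))"
    have mi: "\<bar>Z \<omega> $ i\<bar> \<le> m" for i unfolding m_def by (intro Max_ge) auto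
    have "m \<in> range (\<lambda>i. \<bar>Z \<omega> $ i\<bar>)" unfolding m_def by (intro Max_in) auto
    then obtain j where j: "m = \<bar>Z \<omega> $ j\<bar>" by auto
    have S: "0 \<le> (\<Sum>i\<in>UNIV. \<bar>Z \<omega> $ i\<bar> ^ k)" by (intro sum_nonneg) auto
    have "norm (Z \<omega>) \<le> (\<Sum>i\<in>UNIV. \<bar>Z \<omega> $ i\<bar>)" by (rule norm_le_l1_cart)
    also have "\<dots> \<le> real CARD('b) * m" using sum_mono[of UNIV "\<lambda>i. \<bar>Z \<omega> $ i\<bar>" "\<lambda>_. m"] mi by simp
    finally have "1 + norm (Z \<omega>) \<le> 1 + real CARD('b) * m" by simp
    also have "\<dots> \<le> ?c * max 1 m"
    proof -
      have "real CARD('b) * m \<le> real CARD('b) * max 1 m" by (intro mult_left_mono) auto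
      then show ?thesis unfolding distrib_right by linarith
    qed
    finally have "(1 + norm (Z \<omega>)) ^ k \<le> (?c * max 1 m) ^ k" by (intro power_mono) auto
    also have "\<dots> = ?c ^ k * (max 1 m) ^ k" by (simp add: power_mult_distrib)
    also have "(max 1 m) ^ k \<le> 1 + m ^ k" using j by (simp add: max_def)
    also have "m ^ k \<le> (\<Sum>i\<in>UNIV. \<bar>Z \<omega> $ i\<bar> ^ k)"
      unfolding j by (rule member_le_sum) auto
    finally have "(1 + norm (Z \<omega>)) ^ k \<le> ?c ^ k * (1 + (\<Sum>i\<in>UNIV. \<bar>Z \<omega> $ i\<bar> ^ k))"
      by (simp add: mult_left_mono)
    then show "norm ((1 + norm (Z \<omega>)) ^ k) \<le> norm (?c ^ k * (1 + (\<Sum>i\<in>UNIV. \<bar>Z \<omega> $ i\<bar> ^ k)))"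
      using S by simp
  qed
qed

lemma std_normal_vec_covariance:
  assumes Z: "centred_normal_vec 1 Z"
  shows "integrable M (\<lambda>\<omega>. Z \<omega> $ i * Z \<omega> $ j)"
    and "expectation (\<lambda>\<omega>. Z \<omega> $ i * Z \<omega> $ j) = (if i = j then 1 else 0)"
proof -
  have D: "distributed M lborel (\<lambda>\<omega>. Z \<omega> $ i) std_normal_density" for i
    using Z by (simp add: centred_normal_vec_def)
  have int: "integrable M (\<lambda>\<omega>. (Z \<omega> $ i) ^ k)" for i k
    using integrable_std_normal_moment[of k] D[of i]
    by (subst distributed_integrable[symmetric, where N = lborel and f = std_normal_density]) auto
  have iv: "indep_vars (\<lambda>_. borel) (\<lambda>i \<omega>. Z \<omega> $ i) UNIV"
    using Z by (simp add: centred_normal_vec_def)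
  have "integrable M (\<lambda>\<omega>. Z \<omega> $ i * Z \<omega> $ j) \<and>
    expectation (\<lambda>\<omega>. Z \<omega> $ i * Z \<omega> $ j) = (if i = j then 1 else 0)"
  proof (cases "i = j")
    case True
    have "expectation (\<lambda>\<omega>. (Z \<omega> $ i) ^ 2) = 1"
      using distributed_integral[OF D, of "\<lambda>x. x^2" i] integral_std_normal_moment_even[of 1] by simp
    then show ?thesis using True int[of i 2] by (simp add: power2_eq_square)
  next
    case False
    have "indep_vars (\<lambda>_. borel) (\<lambda>i \<omega>. Z \<omega> $ i) {i, j}"
      using iv by (rule indep_vars_subset) simp
    from indep_vars_lebesgue_integral[OF _ this] indep_vars_integrable[OF _ this]
    show ?thesis
      using int[of _ 1] False standard_normal_distributed_expectation[OF D] by simp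
  qed
  then show "integrable M (\<lambda>\<omega>. Z \<omega> $ i * Z \<omega> $ j)"
    and "expectation (\<lambda>\<omega>. Z \<omega> $ i * Z \<omega> $ j) = (if i = j then 1 else 0)" by auto
qed

text \<open>This is where the Frobenius norm enters: the covariance of \<open>Z\<close> is the identity, so the double
sum over pairs of components collapses to the sum of the squared entries.\<close>

lemma std_normal_vec_matrix_second_moment:
  fixes A :: "real ^ 'm ^ 'd"
  assumes Z: "centred_normal_vec 1 Z"
  shows "integrable M (\<lambda>\<omega>. (norm (A *v Z \<omega>))\<^sup>2)"
    and "expectation (\<lambda>\<omega>. (norm (A *v Z \<omega>))\<^sup>2) = (norm A)\<^sup>2"
proof -
  have eq: "(norm (A *v z))\<^sup>2 = (\<Sum>i\<in>UNIV. \<Sum>j\<in>UNIV. \<Sum>k\<in>UNIV. A $ i $ j * A $ i $ k * (z $ j * z $ k))" for z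
    by (subst norm_vec_power2) (simp add: matrix_vector_mult_def power2_eq_square sum_product algebra_simps)
  show "integrable M (\<lambda>\<omega>. (norm (A *v Z \<omega>))\<^sup>2)"
    unfolding eq using std_normal_vec_covariance[OF Z] by auto
  have "expectation (\<lambda>\<omega>. (norm (A *v Z \<omega>))\<^sup>2)
      = (\<Sum>i\<in>UNIV. \<Sum>j\<in>UNIV. \<Sum>k\<in>UNIV. A $ i $ j * A $ i $ k * (if j = k then 1 else 0))"
    unfolding eq using std_normal_vec_covariance[OF Z] by (simp add: Bochner_Integration.integral_sum)
  also have "\<dots> = (\<Sum>i\<in>UNIV. \<Sum>j\<in>UNIV. (A $ i $ j)\<^sup>2)"
    by (simp add: if_distrib sum.delta power2_eq_square cong: if_cong)
  also have "\<dots> = (norm A)\<^sup>2" by (simp add: norm_vec_power2)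
  finally show "expectation (\<lambda>\<omega>. (norm (A *v Z \<omega>))\<^sup>2) = (norm A)\<^sup>2" .
qed

end

section \<open>Contraction of the moment in one step\<close>

context prob_space begin

text \<open>Divide by the norm of \<open>x\<close> and put \<open>\<eta> = h powr (1 - \<gamma>)\<close>: the growth conditions say that the drift
step has relative size at most \<open>\<eta>\<close> and the noise relative size at most \<open>sqrt \<eta>\<close> times the norm
of \<open>Z\<close>. As \<open>Z\<close> is symmetric, the expectation equals that of the average over \<open>\<plusminus>Z\<close>. The
first-order part of its expansion has expectation at most \<open>- p * \<nu> * h\<close> by dissipativity, and
the error \<open>B * \<eta>\<^sup>2 = B * h * h powr (1 - 2 * \<gamma>)\<close> is at most \<open>\<epsilon> * h\<close> for small \<open>h\<close>, because
\<open>\<gamma> < 1/2\<close>.\<close>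

lemma normal_step_contraction:
  fixes Z :: "'a \<Rightarrow> real ^ 'm" and p \<nu> \<gamma> \<epsilon> :: real
  assumes Z: "centred_normal_vec 1 Z" and p: "2 \<le> p" and \<gamma>: "0 < \<gamma>" "\<gamma> < 1/2" and \<epsilon>: "0 < \<epsilon>"
  obtains \<delta>s where "0 < \<delta>s"
    and "\<And>h x v (A :: real ^ 'm ^ 'd). \<lbrakk>0 < h; h \<le> \<delta>s; norm v * h powr \<gamma> \<le> norm x;
        (norm A)\<^sup>2 * h powr \<gamma> \<le> (norm x)\<^sup>2; x \<bullet> v + (p - 1) / 2 * (norm A)\<^sup>2 \<le> - \<nu> * (norm x)\<^sup>2\<rbrakk> \<Longrightarrow>
      (\<integral>\<^sup>+\<omega>. norm (x + h *\<^sub>R v + A *v (sqrt h *\<^sub>R Z \<omega>)) powr p \<partial>M)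
        \<le> ennreal (exp (- (p * \<nu> - \<epsilon>) * h) * norm x powr p)"
proof -
  define q where "q = p / 2"
  have q: "1 \<le> q" using p by (simp add: q_def)
  obtain K N where K: "0 \<le> K"
    and avg: "\<And>\<eta> \<zeta> a \<rho> b. \<lbrakk>0 \<le> \<eta>; \<eta> \<le> 1; 0 \<le> \<zeta>; \<bar>a\<bar> \<le> 3 * \<eta>; - 1 \<le> a; 0 \<le> \<rho>; \<rho> \<le> \<eta> * \<zeta>\<^sup>2;
        b\<^sup>2 \<le> 4 * (1 + a) * \<rho>\<rbrakk> \<Longrightarrow>
      ((1 + a + \<rho> + b) powr q + (1 + a + \<rho> - b) powr q) / 2
        \<le> 1 + q * a + q * (2 * q - 1) * \<rho> + K * \<eta>\<^sup>2 * (1 + \<zeta>)^N"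
    using powr_symmetric_average[OF q] by blast
  define E where "E = expectation (\<lambda>\<omega>. (1 + norm (Z \<omega>)) ^ N)"
  have E: "0 \<le> E" by (simp add: E_def)
  define B where "B = q + K * E + 1"
  have B: "0 < B" using q K E by (simp add: B_def add_nonneg_pos)
  define \<delta>s where "\<delta>s = min 1 ((\<epsilon> / B) powr (1 / (1 - 2 * \<gamma>)))"
  have \<delta>s: "0 < \<delta>s" using \<epsilon> B by (simp add: \<delta>s_def)
  have mZ: "Z \<in> borel_measurable M" by (rule centred_normal_vec_measurable[OF Z])
  have symm: "distr M borel (\<lambda>\<omega>. - Z \<omega>) = distr M borel Z"
    using distr_centred_normal_vec_unique[OF centred_normal_vec_scaleR[OF Z, of "-1"]] Z by simp
  have "(\<integral>\<^sup>+\<omega>. norm (x + h *\<^sub>R v + A *v (sqrt h *\<^sub>R Z \<omega>)) powr p \<partial>M)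
        \<le> ennreal (exp (- (p * \<nu> - \<epsilon>) * h) * norm x powr p)"
    if h: "0 < h" "h \<le> \<delta>s" and v: "norm v * h powr \<gamma> \<le> norm x"
      and A: "(norm A)\<^sup>2 * h powr \<gamma> \<le> (norm x)\<^sup>2"
      and diss: "x \<bullet> v + (p - 1) / 2 * (norm A)\<^sup>2 \<le> - \<nu> * (norm x)\<^sup>2"
    for h x v and A :: "real ^ 'm ^ 'd"
  proof (cases "x = 0")
    case True
    have "v = 0" "A = 0" using v A True h by (simp_all add: mult_le_0_iff)
    then show ?thesis using True by simp
  next
    case False
    define n where "n = norm x"
    have n: "0 < n" using False by (simp add: n_def)
    define \<eta> where "\<eta> = h powr (1 - \<gamma>)"
    have \<eta>: "0 < \<eta>" "\<eta> \<le> 1"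
      using h \<gamma> by (auto simp: \<eta>_def \<delta>s_def intro: powr_le1)
    have h\<eta>: "h = \<eta> * h powr \<gamma>"
      using h powr_add[of h "1 - \<gamma>" \<gamma>] by (simp add: \<eta>_def)
    have hv: "h * norm v \<le> \<eta> * n"
    proof -
      have "\<eta> * (norm v * h powr \<gamma>) \<le> \<eta> * n" using v \<eta> by (intro mult_left_mono) (auto simp: n_def)
      moreover have "\<eta> * (norm v * h powr \<gamma>) = (\<eta> * h powr \<gamma>) * norm v" by simp
      ultimately show ?thesis by (simp only: h\<eta>[symmetric])
    qed
    have hA: "h * (norm A)\<^sup>2 \<le> \<eta> * n\<^sup>2"
    proof -
      have "\<eta> * ((norm A)\<^sup>2 * h powr \<gamma>) \<le> \<eta> * n\<^sup>2" using A \<eta> by (intro mult_left_mono) (auto simp: n_def)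
      moreover have "\<eta> * ((norm A)\<^sup>2 * h powr \<gamma>) = (\<eta> * h powr \<gamma>) * (norm A)\<^sup>2" by simp
      ultimately show ?thesis by (simp only: h\<eta>[symmetric])
    qed
    define u where "u = x + h *\<^sub>R v"
    \<comment> \<open>Thus \<open>\<bar>u\<bar>\<^sup>2 = n\<^sup>2 * (1 + a)\<close>, and \<open>\<rho>\<close>, \<open>b\<close> are the normalised noise terms of the squared norm.\<close>
    define a where "a = (2 * h * (x \<bullet> v) + (h * norm v)\<^sup>2) / n\<^sup>2"
    define \<rho> where "\<rho> \<omega> = h * (norm (A *v Z \<omega>))\<^sup>2 / n\<^sup>2" for \<omega>
    define b where "b \<omega> = 2 * (u \<bullet> (A *v (sqrt h *\<^sub>R Z \<omega>))) / n\<^sup>2" for \<omega>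
    have u: "(norm u)\<^sup>2 = n\<^sup>2 * (1 + a)"
      using n by (simp add: u_def a_def n_def power2_norm_eq_inner inner_add inner_commute
          power_mult_distrib field_simps) (simp add: power2_eq_square)
    have a1: "- 1 \<le> a"
    proof -
      have "0 \<le> n\<^sup>2 * (1 + a)" unfolding u[symmetric] by simp
      then show ?thesis using n by (simp add: zero_le_mult_iff)
    qed
    have a3: "\<bar>a\<bar> \<le> 3 * \<eta>"
    proof -
      have "\<bar>2 * h * (x \<bullet> v)\<bar> \<le> 2 * (n * (h * norm v))"
        using mult_left_mono[OF Cauchy_Schwarz_ineq2[of x v], of "2 * h"] h
        by (simp add: abs_mult n_def algebra_simps)
      also have "\<dots> \<le> 2 * (n * (\<eta> * n))" using hv n by (intro mult_left_mono) auto
      finally have 1: "\<bar>2 * h * (x \<bullet> v)\<bar> \<le> 2 * \<eta> * n\<^sup>2" by (simp add: power2_eq_square algebra_simps)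
      have "(h * norm v)\<^sup>2 \<le> (\<eta> * n)\<^sup>2" using hv h by (intro power_mono) auto
      also have "\<dots> \<le> \<eta> * n\<^sup>2"
        using \<eta> power_decreasing[of 1 2 \<eta>] by (simp add: power_mult_distrib mult_right_mono)
      finally have "\<bar>2 * h * (x \<bullet> v) + (h * norm v)\<^sup>2\<bar> \<le> 3 * \<eta> * n\<^sup>2"
        using 1 zero_le_power2[of "h * norm v"] unfolding abs_le_iff by linarith
      then show ?thesis using n by (simp add: a_def abs_divide divide_le_eq)
    qed
    have \<rho>0: "0 \<le> \<rho> \<omega>" for \<omega> using h by (simp add: \<rho>_def)
    have \<rho>1: "\<rho> \<omega> \<le> \<eta> * (norm (Z \<omega>))\<^sup>2" for \<omega>
    proof -
      have "h * (norm (A *v Z \<omega>))\<^sup>2 \<le> h * (norm A * norm (Z \<omega>))\<^sup>2"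
        using h norm_matrix_vector_mult_le[of A "Z \<omega>"] by (intro mult_left_mono power_mono) auto
      also have "\<dots> = (h * (norm A)\<^sup>2) * (norm (Z \<omega>))\<^sup>2" by (simp add: power_mult_distrib)
      also have "\<dots> \<le> (\<eta> * n\<^sup>2) * (norm (Z \<omega>))\<^sup>2" using hA by (intro mult_right_mono) auto
      finally show ?thesis using n by (simp add: \<rho>_def divide_le_eq mult.commute mult.left_commute)
    qed
    have w: "(norm (A *v (sqrt h *\<^sub>R Z \<omega>)))\<^sup>2 = n\<^sup>2 * \<rho> \<omega>" for \<omega>
      using h n by (simp add: \<rho>_def matrix_vector_mult_scaleR power_mult_distrib)
    have b1: "(b \<omega>)\<^sup>2 \<le> 4 * (1 + a) * \<rho> \<omega>" for \<omega>
    proof -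
      have "(u \<bullet> (A *v (sqrt h *\<^sub>R Z \<omega>)))\<^sup>2 \<le> (norm u)\<^sup>2 * (norm (A *v (sqrt h *\<^sub>R Z \<omega>)))\<^sup>2"
        by (metis Cauchy_Schwarz_ineq power2_norm_eq_inner)
      also have "\<dots> = n\<^sup>2 * (1 + a) * (n\<^sup>2 * \<rho> \<omega>)" unfolding u w ..
      finally have "(n\<^sup>2 * b \<omega>)\<^sup>2 \<le> (n\<^sup>2)\<^sup>2 * (4 * (1 + a) * \<rho> \<omega>)"
        using n by (simp add: b_def power_mult_distrib power2_eq_square algebra_simps)
      then show ?thesis using n by (simp add: power_mult_distrib)
    qed
    define \<Phi> where "\<Phi> z = norm (x + h *\<^sub>R v + A *v (sqrt h *\<^sub>R z)) powr p" for z
    have m\<Phi>: "\<Phi> \<in> borel_measurable borel"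
      unfolding \<Phi>_def
      by measurable
    have norm_powr: "norm y powr p = n powr p * s powr q" if "(norm y)\<^sup>2 = n\<^sup>2 * s" for y :: "real ^ 'd" and s
    proof -
      have sq: "r powr p = r\<^sup>2 powr q" if "0 \<le> r" for r :: real
      proof -
        have "r\<^sup>2 = r powr 2" using that by simp
        then show ?thesis by (simp only: powr_powr) (simp add: q_def)
      qed
      have "0 \<le> n\<^sup>2 * s" unfolding that[symmetric] by simp
      then have "0 \<le> s" using n by (simp add: zero_le_mult_iff)
      have "norm y powr p = (norm y)\<^sup>2 powr q" by (rule sq) simp
      also have "\<dots> = (n\<^sup>2) powr q * s powr q" unfolding that using \<open>0 \<le> s\<close> by (simp add: powr_mult)
      also have "(n\<^sup>2) powr q = n powr p" using n by (simp add: sq)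
      finally show ?thesis .
    qed
    have nb: "n\<^sup>2 * b \<omega> = 2 * (u \<bullet> (A *v (sqrt h *\<^sub>R Z \<omega>)))" for \<omega>
      using n by (simp add: b_def)
    have sq_add: "(norm (u + y))\<^sup>2 = (norm u)\<^sup>2 + 2 * (u \<bullet> y) + (norm y)\<^sup>2"
      and sq_diff: "(norm (u - y))\<^sup>2 = (norm u)\<^sup>2 - 2 * (u \<bullet> y) + (norm y)\<^sup>2" for y
      by (simp_all add: power2_norm_eq_inner inner_add inner_diff inner_commute)
    have \<Phi>p: "\<Phi> (Z \<omega>) = n powr p * (1 + a + \<rho> \<omega> + b \<omega>) powr q" for \<omega>
    proof -
      have "(norm (u + A *v (sqrt h *\<^sub>R Z \<omega>)))\<^sup>2 = n\<^sup>2 * (1 + a + \<rho> \<omega> + b \<omega>)"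
        unfolding sq_add u w nb[symmetric] by (simp add: algebra_simps)
      then show ?thesis unfolding \<Phi>_def u_def[symmetric] by (rule norm_powr)
    qed
    have \<Phi>m: "\<Phi> (- Z \<omega>) = n powr p * (1 + a + \<rho> \<omega> - b \<omega>) powr q" for \<omega>
    proof -
      have "A *v (sqrt h *\<^sub>R - Z \<omega>) = - (A *v (sqrt h *\<^sub>R Z \<omega>))"
        using matrix_vector_mult_scaleR[of A "- sqrt h" "Z \<omega>"] by (simp add: matrix_vector_mult_scaleR)
      moreover have "(norm (u - A *v (sqrt h *\<^sub>R Z \<omega>)))\<^sup>2 = n\<^sup>2 * (1 + a + \<rho> \<omega> - b \<omega>)"
        unfolding sq_diff u w nb[symmetric] by (simp add: algebra_simps)
      ultimately show ?thesis unfolding \<Phi>_def u_def[symmetric] by (simp add: norm_powr)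
    qed
    \<comment> \<open>The deterministic majorant of the average over the two signs, whose expectation is explicit.\<close>
    define G where "G \<omega> = n powr p * (1 + q * a + q * (2 * q - 1) * \<rho> \<omega> + K * \<eta>\<^sup>2 * (1 + norm (Z \<omega>)) ^ N)" for \<omega>
    have G: "(\<Phi> (Z \<omega>) + \<Phi> (- Z \<omega>)) / 2 \<le> G \<omega>" for \<omega>
    proof -
      have "(\<Phi> (Z \<omega>) + \<Phi> (- Z \<omega>)) / 2
          = n powr p * (((1 + a + \<rho> \<omega> + b \<omega>) powr q + (1 + a + \<rho> \<omega> - b \<omega>) powr q) / 2)"
        unfolding \<Phi>p \<Phi>m by (simp add: field_simps)
      also have "\<dots> \<le> G \<omega>" unfolding G_def
        using \<eta> a1 a3 \<rho>0 \<rho>1 b1 by (intro mult_left_mono avg) auto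
      finally show ?thesis .
    qed
    have \<Phi>0: "0 \<le> \<Phi> z" for z by (simp add: \<Phi>_def)
    have \<rho>int: "integrable M \<rho>"
      and \<rho>exp: "expectation \<rho> = h * (norm A)\<^sup>2 / n\<^sup>2"
      unfolding \<rho>_def using std_normal_vec_matrix_second_moment[OF Z, of A] by auto
    have Zint: "integrable M (\<lambda>\<omega>. (1 + norm (Z \<omega>)) ^ N)"
      by (rule std_normal_vec_moment_integrable[OF Z])
    have Gint: "integrable M G" unfolding G_def using \<rho>int Zint by auto
    have Gexp: "expectation G = n powr p *
        (1 + q * a + q * (2 * q - 1) * (h * (norm A)\<^sup>2 / n\<^sup>2) + K * \<eta>\<^sup>2 * E)"
      unfolding G_def using \<rho>int Zint by (simp add: prob_space \<rho>exp E_def)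
    have "(\<integral>\<^sup>+\<omega>. \<Phi> (Z \<omega>) \<partial>M) \<le> ennreal (expectation G)"
    proof -
      have flip: "(\<integral>\<^sup>+\<omega>. \<Phi> (- Z \<omega>) \<partial>M) = (\<integral>\<^sup>+\<omega>. \<Phi> (Z \<omega>) \<partial>M)"
        using nn_integral_distr[of "\<lambda>\<omega>. - Z \<omega>" M borel "\<lambda>z. ennreal (\<Phi> z)"]
          nn_integral_distr[of Z M borel "\<lambda>z. ennreal (\<Phi> z)"] mZ m\<Phi> symm by simp
      have half: "ennreal (1/2) + ennreal (1/2) = 1" by (subst ennreal_plus[symmetric]) auto
      have "(\<integral>\<^sup>+\<omega>. \<Phi> (Z \<omega>) \<partial>M) = ennreal (1/2) * (\<integral>\<^sup>+\<omega>. \<Phi> (Z \<omega>) \<partial>M) + ennreal (1/2) * (\<integral>\<^sup>+\<omega>. \<Phi> (- Z \<omega>) \<partial>M)"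
        unfolding flip distrib_right[symmetric] half by simp
      also have "\<dots> = (\<integral>\<^sup>+\<omega>. ennreal (1/2) * \<Phi> (Z \<omega>) + ennreal (1/2) * \<Phi> (- Z \<omega>) \<partial>M)"
        using mZ m\<Phi> by (simp add: nn_integral_add nn_integral_cmult)
      also have "\<dots> = (\<integral>\<^sup>+\<omega>. ennreal ((\<Phi> (Z \<omega>) + \<Phi> (- Z \<omega>)) / 2) \<partial>M)"
        using \<Phi>0 by (intro nn_integral_cong) (simp only: ennreal_mult'[symmetric] ennreal_plus[symmetric] add_divide_distrib, simp)
      also have "\<dots> \<le> (\<integral>\<^sup>+\<omega>. ennreal (G \<omega>) \<partial>M)"
        using G by (intro nn_integral_mono ennreal_leI)
      also have "\<dots> = ennreal (expectation G)"
      proof (intro nn_integral_eq_integral Gint AE_I2)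
        fix \<omega>
        have "0 \<le> (\<Phi> (Z \<omega>) + \<Phi> (- Z \<omega>)) / 2" using \<Phi>0 by (intro divide_nonneg_nonneg add_nonneg_nonneg) auto
        then show "0 \<le> G \<omega>" using G by (rule order_trans)
      qed
      finally show ?thesis .
    qed
    also have "expectation G \<le> exp (- (p * \<nu> - \<epsilon>) * h) * norm x powr p"
    proof -
      have drift: "q * a + q * (2 * q - 1) * (h * (norm A)\<^sup>2 / n\<^sup>2) \<le> - p * \<nu> * h + q * \<eta>\<^sup>2"
      proof -
        have "q * (2 * h * (x \<bullet> v)) + q * (2 * q - 1) * (h * (norm A)\<^sup>2)
            = p * h * (x \<bullet> v + (p - 1) / 2 * (norm A)\<^sup>2)"
          by (simp add: q_def field_simps)
        also have "\<dots> \<le> p * h * (- \<nu> * n\<^sup>2)"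
          using diss p h by (intro mult_left_mono) (auto simp: n_def)
        finally have "q * (2 * h * (x \<bullet> v)) + q * (2 * q - 1) * (h * (norm A)\<^sup>2) \<le> p * h * (- \<nu> * n\<^sup>2)" .
        moreover have "q * (h * norm v)\<^sup>2 \<le> q * (\<eta> * n)\<^sup>2"
          using hv h q by (intro mult_left_mono power_mono) auto
        ultimately have "q * (2 * h * (x \<bullet> v) + (h * norm v)\<^sup>2) + q * (2 * q - 1) * (h * (norm A)\<^sup>2)
            \<le> (- p * \<nu> * h + q * \<eta>\<^sup>2) * n\<^sup>2"
          by (simp add: algebra_simps power_mult_distrib)
        then have "(q * (2 * h * (x \<bullet> v) + (h * norm v)\<^sup>2) + q * (2 * q - 1) * (h * (norm A)\<^sup>2)) / n\<^sup>2
            \<le> - p * \<nu> * h + q * \<eta>\<^sup>2"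
          using n by (simp add: divide_le_eq)
        then show ?thesis by (simp only: a_def times_divide_eq_right add_divide_distrib[symmetric])
      qed
      have "B * h powr (1 - 2 * \<gamma>) \<le> \<epsilon>"
      proof -
        have "h powr (1 - 2 * \<gamma>) \<le> ((\<epsilon> / B) powr (1 / (1 - 2 * \<gamma>))) powr (1 - 2 * \<gamma>)"
          using h \<gamma> by (intro powr_mono2) (auto simp: \<delta>s_def)
        also have "\<dots> = \<epsilon> / B" using \<gamma> \<epsilon> B by (simp add: powr_powr)
        finally show ?thesis using B by (simp add: field_simps)
      qed
      moreover have "\<eta>\<^sup>2 = h * h powr (1 - 2 * \<gamma>)"
      proof -
        have "\<eta>\<^sup>2 = h powr (1 + (1 - 2 * \<gamma>))"
          using h by (simp add: \<eta>_def power2_eq_square flip: powr_add)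
        also have "\<dots> = h * h powr (1 - 2 * \<gamma>)" using h by (subst powr_add) simp
        finally show ?thesis .
      qed
      ultimately have "B * \<eta>\<^sup>2 \<le> \<epsilon> * h" using h mult_left_mono[of "B * h powr (1 - 2 * \<gamma>)" \<epsilon> h]
        by (simp add: algebra_simps)
      moreover have "q * \<eta>\<^sup>2 + K * \<eta>\<^sup>2 * E \<le> B * \<eta>\<^sup>2" by (simp add: B_def algebra_simps)
      ultimately have "1 + q * a + q * (2 * q - 1) * (h * (norm A)\<^sup>2 / n\<^sup>2) + K * \<eta>\<^sup>2 * E
          \<le> 1 + (- (p * \<nu> - \<epsilon>) * h)"
        using drift by (simp add: algebra_simps)
      also have "\<dots> \<le> exp (- (p * \<nu> - \<epsilon>) * h)" by (rule exp_ge_add_one_self)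
      finally have "n powr p * (1 + q * a + q * (2 * q - 1) * (h * (norm A)\<^sup>2 / n\<^sup>2) + K * \<eta>\<^sup>2 * E)
          \<le> n powr p * exp (- (p * \<nu> - \<epsilon>) * h)" by (intro mult_left_mono) auto
      then show ?thesis by (simp add: Gexp n_def mult.commute)
    qed
    finally show ?thesis by (simp add: \<Phi>_def ennreal_leI)
  qed
  then show ?thesis using that \<delta>s by blast
qed

end

section \<open>Random times and increments after the past\<close>

lemma floor_grid_tendsto:
  fixes r :: real
  assumes "0 \<le> r"
  shows "(\<lambda>k. real (nat \<lfloor>real (Suc k) * r\<rfloor>) / real (Suc k)) \<longlonglongrightarrow> r"
proof (rule tendsto_sandwich[where f = "\<lambda>k. r - 1 / real (Suc k)" and h = "\<lambda>_. r"])
  show "(\<lambda>k. r - 1 / real (Suc k)) \<longlonglongrightarrow> r"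
    using tendsto_diff[OF tendsto_const LIMSEQ_inverse_real_of_nat, of r] by (simp add: inverse_eq_divide)
  have b: "real (Suc k) * r - 1 \<le> real (nat \<lfloor>real (Suc k) * r\<rfloor>)"
    "real (nat \<lfloor>real (Suc k) * r\<rfloor>) \<le> real (Suc k) * r" for k
    using assms mult_nonneg_nonneg[of "real (Suc k)" r] by linarith+
  show "\<forall>\<^sub>F k in sequentially. r - 1 / real (Suc k) \<le> real (nat \<lfloor>real (Suc k) * r\<rfloor>) / real (Suc k)"
    using b(1) by (intro always_eventually allI) (simp add: pos_le_divide_eq left_diff_distrib mult.commute[of r] del: of_nat_Suc)
  show "\<forall>\<^sub>F k in sequentially. real (nat \<lfloor>real (Suc k) * r\<rfloor>) / real (Suc k) \<le> r"
    using b(2) by (intro always_eventually allI) (simp add: pos_divide_le_eq mult.commute[of r] del: of_nat_Suc)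
qed simp

lemma ceiling_grid_tendsto:
  fixes r :: real
  assumes "0 \<le> r"
  shows "(\<lambda>k. real (nat \<lceil>real (Suc k) * r\<rceil>) / real (Suc k)) \<longlonglongrightarrow> r"
proof (rule tendsto_sandwich[where f = "\<lambda>_. r" and h = "\<lambda>k. r + 1 / real (Suc k)"])
  show "(\<lambda>k. r + 1 / real (Suc k)) \<longlonglongrightarrow> r"
    using tendsto_add[OF tendsto_const LIMSEQ_inverse_real_of_nat, of r] by (simp add: inverse_eq_divide)
  have b: "real (nat \<lceil>real (Suc k) * r\<rceil>) \<le> real (Suc k) * r + 1"
    "real (Suc k) * r \<le> real (nat \<lceil>real (Suc k) * r\<rceil>)" for k
    using assms mult_nonneg_nonneg[of "real (Suc k)" r] by linarith+
  show "\<forall>\<^sub>F k in sequentially. real (nat \<lceil>real (Suc k) * r\<rceil>) / real (Suc k) \<le> r + 1 / real (Suc k)"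
    using b(1) by (intro always_eventually allI) (simp add: pos_divide_le_eq distrib_right mult.commute[of r] del: of_nat_Suc)
  show "\<forall>\<^sub>F k in sequentially. r \<le> real (nat \<lceil>real (Suc k) * r\<rceil>) / real (Suc k)"
    using b(2) by (intro always_eventually allI) (simp add: pos_le_divide_eq mult.commute[of r] del: of_nat_Suc)
qed simp

text \<open>Progressive measurability of continuous processes. Applied to \<open>\<lambda>t. W (min t u)\<close> and the
\<open>\<sigma>\<close>-algebra at time \<open>u\<close>, it shows that the value at a random time before \<open>u\<close> is known at time
\<open>u\<close>.\<close>

lemma borel_measurable_continuous_process_at_random_time:
  fixes X :: "real \<Rightarrow> 'a \<Rightarrow> 'b :: metric_space"
  assumes X: "\<And>t. 0 \<le> t \<Longrightarrow> X t \<in> borel_measurable G"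
    and cont: "\<And>\<omega>. \<omega> \<in> space G \<Longrightarrow> continuous_on {0..} (\<lambda>t. X t \<omega>)"
    and \<tau>[measurable]: "\<tau> \<in> borel_measurable G" and pos: "\<And>\<omega>. 0 \<le> \<tau> \<omega>"
  shows "(\<lambda>\<omega>. X (\<tau> \<omega>) \<omega>) \<in> borel_measurable G"
proof (rule borel_measurable_LIMSEQ_metric)
  fix k
  show "(\<lambda>\<omega>. X (real (nat \<lfloor>real (Suc k) * \<tau> \<omega>\<rfloor>) / real (Suc k)) \<omega>) \<in> borel_measurable G"
    by (rule measurable_compose_countable[where f = "\<lambda>i. X (real i / real (Suc k))"
          and g = "\<lambda>\<omega>. nat \<lfloor>real (Suc k) * \<tau> \<omega>\<rfloor>"]) (auto intro!: X)
next
  fix \<omega> assume "\<omega> \<in> space G"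
  then show "(\<lambda>k. X (real (nat \<lfloor>real (Suc k) * \<tau> \<omega>\<rfloor>) / real (Suc k)) \<omega>) \<longlonglongrightarrow> X (\<tau> \<omega>) \<omega>"
    by (intro continuous_on_tendsto_compose[OF cont floor_grid_tendsto]) (auto simp: pos)
qed

lemma nn_integral_le_by_countable_partition:
  fixes c :: "'a \<Rightarrow> 'c :: countable"
  assumes [measurable]: "c \<in> measurable M (count_space UNIV)"
      "A \<in> borel_measurable M" "B \<in> borel_measurable M"
    and le: "\<And>k. (\<integral>\<^sup>+\<omega>. A \<omega> * indicator {k} (c \<omega>) \<partial>M) \<le> (\<integral>\<^sup>+\<omega>. B \<omega> * indicator {k} (c \<omega>) \<partial>M)"
  shows "(\<integral>\<^sup>+\<omega>. A \<omega> \<partial>M) \<le> (\<integral>\<^sup>+\<omega>. B \<omega> \<partial>M)"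
proof -
  have split: "(\<integral>\<^sup>+\<omega>. D \<omega> \<partial>M) = (\<Sum>n. \<integral>\<^sup>+\<omega>. D \<omega> * indicator {n} (to_nat (c \<omega>)) \<partial>M)"
    if [measurable]: "D \<in> borel_measurable M" for D :: "'a \<Rightarrow> ennreal"
  proof -
    have "(\<Sum>n. D \<omega> * indicator {n} (to_nat (c \<omega>))) = D \<omega>" for \<omega>
      by (subst suminf_finite[of "{to_nat (c \<omega>)}"]) auto
    then have "(\<integral>\<^sup>+\<omega>. D \<omega> \<partial>M) = (\<integral>\<^sup>+\<omega>. (\<Sum>n. D \<omega> * indicator {n} (to_nat (c \<omega>))) \<partial>M)" by simp
    also have "\<dots> = (\<Sum>n. \<integral>\<^sup>+\<omega>. D \<omega> * indicator {n} (to_nat (c \<omega>)) \<partial>M)"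
      by (rule nn_integral_suminf) measurable
    finally show ?thesis .
  qed
  have "(\<integral>\<^sup>+\<omega>. A \<omega> * indicator {n} (to_nat (c \<omega>)) \<partial>M) \<le> (\<integral>\<^sup>+\<omega>. B \<omega> * indicator {n} (to_nat (c \<omega>)) \<partial>M)" for n
  proof (cases "n \<in> range (to_nat :: 'c \<Rightarrow> nat)")
    case True
    then obtain k :: 'c where "n = to_nat k" by auto
    then show ?thesis using le[of k] by (simp add: indicator_def)
  next
    case False
    then have "indicator {n} (to_nat (c \<omega>)) = (0 :: ennreal)" for \<omega> by (auto simp: indicator_def)
    then show ?thesis by simp
  qed
  then show ?thesis unfolding split[OF assms(2)] split[OF assms(3)] by (intro suminf_le) auto
qed

text \<open>The freezing lemma: a quantity known from the past may be held fixed while integrating over an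
independent increment. The joint law is identified with a product measure on rectangles, where
the claim is the definition of independence.\<close>

lemma (in prob_space) nn_integral_indep_of_subalgebra:
  assumes sub: "subalgebra M G" and X: "X \<in> measurable G N" and \<xi>: "\<xi> \<in> borel_measurable M"
    and indep: "indep_set (sets G) (sets (vimage_algebra (space M) \<xi> borel))"
    and \<phi>[measurable]: "\<phi> \<in> borel_measurable (N \<Otimes>\<^sub>M borel)"
  shows "(\<integral>\<^sup>+\<omega>. \<phi> (X \<omega>, \<xi> \<omega>) \<partial>M) = (\<integral>\<^sup>+\<omega>. \<integral>\<^sup>+\<omega>'. \<phi> (X \<omega>, \<xi> \<omega>') \<partial>M \<partial>M)"
proof -
  have X'[measurable]: "X \<in> measurable M N" by (rule measurable_from_subalg[OF sub X])
  note \<xi>[measurable]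
  interpret C: prob_space "distr M N X" by (rule prob_space_distr) simp
  interpret D: prob_space "distr M borel \<xi>" by (rule prob_space_distr) simp
  have pair: "distr M N X \<Otimes>\<^sub>M distr M borel \<xi> = distr M (N \<Otimes>\<^sub>M borel) (\<lambda>\<omega>. (X \<omega>, \<xi> \<omega>))"
  proof (rule pair_measure_eqI)
    fix A B assume "A \<in> sets (distr M N X)" "B \<in> sets (distr M borel \<xi>)"
    then have [measurable]: "A \<in> sets N" "B \<in> sets borel" by auto
    have "X -` A \<inter> space M \<in> sets G"
      using measurable_sets[OF X] sub by (simp add: subalgebra_def)
    moreover have "\<xi> -` B \<inter> space M \<in> sets (vimage_algebra (space M) \<xi> borel)"
      by (intro in_vimage_algebra) simp
    ultimately have "prob ((X -` A \<inter> space M) \<inter> (\<xi> -` B \<inter> space M))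
        = prob (X -` A \<inter> space M) * prob (\<xi> -` B \<inter> space M)"
      using indep unfolding indep_sets2_eq by blast
    moreover have "(X -` A \<inter> space M) \<inter> (\<xi> -` B \<inter> space M) = (\<lambda>\<omega>. (X \<omega>, \<xi> \<omega>)) -` (A \<times> B) \<inter> space M"
      by auto
    ultimately show "emeasure (distr M N X) A * emeasure (distr M borel \<xi>) B
        = emeasure (distr M (N \<Otimes>\<^sub>M borel) (\<lambda>\<omega>. (X \<omega>, \<xi> \<omega>))) (A \<times> B)"
      by (simp add: emeasure_distr emeasure_eq_measure ennreal_mult[symmetric])
  qed (auto intro: C.sigma_finite_measure_axioms D.sigma_finite_measure_axioms)
  have "(\<integral>\<^sup>+\<omega>. \<phi> (X \<omega>, \<xi> \<omega>) \<partial>M) = (\<integral>\<^sup>+z. \<phi> z \<partial>(distr M N X \<Otimes>\<^sub>M distr M borel \<xi>))"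
    unfolding pair by (subst nn_integral_distr) auto
  also have "\<dots> = (\<integral>\<^sup>+x. \<integral>\<^sup>+y. \<phi> (x, y) \<partial>distr M borel \<xi> \<partial>distr M N X)"
    by (rule D.nn_integral_fst[symmetric]) simp
  also have "\<dots> = (\<integral>\<^sup>+\<omega>. \<integral>\<^sup>+\<omega>'. \<phi> (X \<omega>, \<xi> \<omega>') \<partial>M \<partial>M)"
  proof (subst nn_integral_distr)
    show "(\<integral>\<^sup>+\<omega>. \<integral>\<^sup>+y. \<phi> (X \<omega>, y) \<partial>distr M borel \<xi> \<partial>M) = (\<integral>\<^sup>+\<omega>. \<integral>\<^sup>+\<omega>'. \<phi> (X \<omega>, \<xi> \<omega>') \<partial>M \<partial>M)"
      using measurable_space[OF X'] measurable_compose[OF measurable_Pair1' \<phi>]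
      by (intro nn_integral_cong) (simp add: nn_integral_distr)
  qed measurable
  finally show ?thesis .
qed

lemma (in brownian_motion) centred_normal_vec_increment:
  assumes "0 \<le> s" "s < t"
  shows "centred_normal_vec (sqrt (t - s)) (\<lambda>\<omega>. W t \<omega> - W s \<omega>)"
  using increments_indep_components[OF assms] increments_normal[OF assms]
  by (simp add: centred_normal_vec_def)

text \<open>The inner integral runs over one fixed normal vector, whatever \<open>s\<close> and \<open>h\<close> are, so that the
threshold for the step size can be chosen before the steps are known.\<close>

lemma (in brownian_motion) nn_integral_increment_after:
  assumes s: "0 \<le> s" "0 < h" and X: "X \<in> measurable (F s) N"
    and \<phi>[measurable]: "\<phi> \<in> borel_measurable (N \<Otimes>\<^sub>M borel)"
  shows "(\<integral>\<^sup>+\<omega>. \<phi> (X \<omega>, W (s + h) \<omega> - W s \<omega>) \<partial>M)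
    = (\<integral>\<^sup>+\<omega>. \<integral>\<^sup>+\<omega>'. \<phi> (X \<omega>, sqrt h *\<^sub>R (W 1 \<omega>' - W 0 \<omega>')) \<partial>M \<partial>M)"
proof -
  let ?\<xi> = "\<lambda>\<omega>. W (s + h) \<omega> - W s \<omega>" and ?\<zeta> = "\<lambda>\<omega>. sqrt h *\<^sub>R (W 1 \<omega> - W 0 \<omega>)"
  have \<xi>: "centred_normal_vec (sqrt h) ?\<xi>"
    using centred_normal_vec_increment[of s "s + h"] s by simp
  have \<zeta>: "centred_normal_vec (sqrt h) ?\<zeta>"
    using centred_normal_vec_scaleR[OF centred_normal_vec_increment[of 0 1], of "sqrt h"] s by simp
  have "X \<in> measurable M N"
    by (rule measurable_from_subalg[OF filtration_subalgebra[OF s(1)] X])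
  note [measurable] = centred_normal_vec_measurable[OF \<xi>] centred_normal_vec_measurable[OF \<zeta>]
  have "(\<integral>\<^sup>+\<omega>. \<phi> (X \<omega>, ?\<xi> \<omega>) \<partial>M) = (\<integral>\<^sup>+\<omega>. \<integral>\<^sup>+\<omega>'. \<phi> (X \<omega>, ?\<xi> \<omega>') \<partial>M \<partial>M)"
    using s by (intro nn_integral_indep_of_subalgebra[OF filtration_subalgebra[OF s(1)] X] \<phi>
        increments_indep_past) auto
  also have "\<dots> = (\<integral>\<^sup>+\<omega>. \<integral>\<^sup>+\<omega>'. \<phi> (X \<omega>, ?\<zeta> \<omega>') \<partial>M \<partial>M)"
  proof (rule nn_integral_cong)
    fix \<omega> assume "\<omega> \<in> space M"
    then have X': "X \<omega> \<in> space N" using measurable_space[OF \<open>X \<in> measurable M N\<close>] by blast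
    have "(\<integral>\<^sup>+\<omega>'. \<phi> (X \<omega>, U \<omega>') \<partial>M) = (\<integral>\<^sup>+z. \<phi> (X \<omega>, z) \<partial>distr M borel U)"
      if [measurable]: "U \<in> borel_measurable M" for U
      using measurable_compose[OF measurable_Pair1'[OF X'] \<phi>] by (simp add: nn_integral_distr)
    from this[of ?\<xi>] this[of ?\<zeta>] distr_centred_normal_vec_unique[OF \<xi> \<zeta>]
    show "(\<integral>\<^sup>+\<omega>'. \<phi> (X \<omega>, ?\<xi> \<omega>') \<partial>M) = (\<integral>\<^sup>+\<omega>'. \<phi> (X \<omega>, ?\<zeta> \<omega>') \<partial>M)" by simp
  qed
  finally show ?thesis .
qed

section \<open>From deterministic to random grid points\<close>

text \<open>The adaptive scheme with a step rule that may also look at the clock. Taking a step of length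
zero leaves the state unchanged, so stopping the scheme, at a deterministic time or on leaving a
ball, is merely another choice of the step rule.\<close>

primrec em_chain ::
  "(real ^ 'd \<Rightarrow> real ^ 'd) \<Rightarrow> (real ^ 'd \<Rightarrow> real ^ 'm ^ 'd) \<Rightarrow> (real \<Rightarrow> real ^ 'd \<Rightarrow> real) \<Rightarrow> real ^ 'd
    \<Rightarrow> (real \<Rightarrow> real ^ 'm) \<Rightarrow> nat \<Rightarrow> real \<times> (real ^ 'd)" where
  "em_chain f g \<eta> x\<^sub>0 w 0 = (0, x\<^sub>0)"
| "em_chain f g \<eta> x\<^sub>0 w (Suc n) =
    (let (s, y) = em_chain f g \<eta> x\<^sub>0 w n; h = \<eta> s y
     in (s + h, y + h *\<^sub>R f y + g y *v (w (s + h) - w s)))"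

text \<open>Everything about the coefficients and the noise that the passage from one step to the whole
scheme uses. The contraction is assumed only for steps that start at a deterministic time \<open>s\<close>
and have a deterministic length \<open>h\<close>; the weight \<open>V\<close> turns it into a statement conditional on the
past of \<open>s\<close>. The alternative \<open>Y \<omega> = 0\<close> is there so that \<open>Y\<close> can be set to zero off an event.
Paths are continuous everywhere, not just almost surely, because random times are inserted into
them.\<close>

locale contracting_scheme = prob_space M
  for M :: "'w measure" +
  fixes F :: "real \<Rightarrow> 'w measure"
    and W :: "real \<Rightarrow> 'w \<Rightarrow> real ^ 'm"
    and f :: "real ^ 'd \<Rightarrow> real ^ 'd"
    and g :: "real ^ 'd \<Rightarrow> real ^ 'm ^ 'd"
    and \<delta> :: "real ^ 'd \<Rightarrow> real"
    and p \<kappa> :: real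
    and x\<^sub>0 :: "real ^ 'd"
  assumes subalg: "\<And>t. 0 \<le> t \<Longrightarrow> subalgebra M (F t)"
    and F_mono: "\<And>s t. 0 \<le> s \<Longrightarrow> s \<le> t \<Longrightarrow> subalgebra (F t) (F s)"
    and W_adapted: "\<And>t. 0 \<le> t \<Longrightarrow> W t \<in> borel_measurable (F t)"
    and W_continuous: "\<And>\<omega>. \<omega> \<in> space M \<Longrightarrow> continuous_on {0..} (\<lambda>t. W t \<omega>)"
    and f_continuous: "continuous_on UNIV f"
    and g_continuous: "continuous_on UNIV g"
    and \<delta>_continuous: "continuous_on UNIV \<delta>"
    and \<delta>_pos: "\<And>y. 0 < \<delta> y"
    and p_pos: "0 < p"
    and \<kappa>_nonneg: "0 \<le> \<kappa>"
    and contraction: "\<And>s h V Y. \<lbrakk>0 \<le> s; 0 < h; V \<in> borel_measurable (F s); \<And>\<omega>. 0 \<le> V \<omega>;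
        Y \<in> borel_measurable (F s); \<And>\<omega>. Y \<omega> = 0 \<or> h \<le> \<delta> (Y \<omega>)\<rbrakk> \<Longrightarrow>
      (\<integral>\<^sup>+\<omega>. ennreal (V \<omega> * (exp (\<kappa> * h) *
          norm (Y \<omega> + h *\<^sub>R f (Y \<omega>) + g (Y \<omega>) *v (W (s + h) \<omega> - W s \<omega>)) powr p)) \<partial>M)
        \<le> (\<integral>\<^sup>+\<omega>. ennreal (V \<omega> * norm (Y \<omega>) powr p) \<partial>M)"
begin

lemma f_measurable[measurable]: "f \<in> borel_measurable borel"
  by (rule borel_measurable_continuous_onI[OF f_continuous])

lemma g_measurable[measurable]: "g \<in> borel_measurable borel"
  by (rule borel_measurable_continuous_onI[OF g_continuous])

lemma \<delta>_measurable[measurable]: "\<delta> \<in> borel_measurable borel"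
  by (rule borel_measurable_continuous_onI[OF \<delta>_continuous])

lemma space_F: "0 \<le> t \<Longrightarrow> space (F t) = space M"
  using subalg by (simp add: subalgebra_def)

lemma W_measurable: "0 \<le> t \<Longrightarrow> W t \<in> borel_measurable M"
  using measurable_from_subalg[OF subalg W_adapted] by blast

lemma W_at_bounded_time_measurable:
  assumes u: "0 \<le> u" and [measurable]: "\<tau> \<in> borel_measurable (F u)" and "\<And>\<omega>. 0 \<le> \<tau> \<omega>"
  shows "(\<lambda>\<omega>. W (min (\<tau> \<omega>) u) \<omega>) \<in> borel_measurable (F u)"
proof (rule borel_measurable_continuous_process_at_random_time[where X = "\<lambda>t. W (min t u)"])
  fix t :: real assume "0 \<le> t"
  then show "W (min t u) \<in> borel_measurable (F u)"
    using u by (intro measurable_from_subalg[OF F_mono W_adapted]) auto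
next
  fix \<omega> assume "\<omega> \<in> space (F u)"
  then show "continuous_on {0..} (\<lambda>t. W (min t u) \<omega>)"
    using u by (intro continuous_on_compose2[OF W_continuous] continuous_intros) (auto simp: space_F)
qed (use assms in auto)

lemma W_at_random_time_measurable:
  assumes [measurable]: "\<tau> \<in> borel_measurable M" and "\<And>\<omega>. 0 \<le> \<tau> \<omega>"
  shows "(\<lambda>\<omega>. W (\<tau> \<omega>) \<omega>) \<in> borel_measurable M"
  by (rule borel_measurable_continuous_process_at_random_time[OF W_measurable W_continuous assms])

end

locale contracting_chain = contracting_scheme M F W f g \<delta> p \<kappa> x\<^sub>0
  for M :: "'w measure" and F and W :: "real \<Rightarrow> 'w \<Rightarrow> real ^ 'm"
    and f :: "real ^ 'd \<Rightarrow> real ^ 'd" and g and \<delta> and p \<kappa> and x\<^sub>0 +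
  fixes \<eta> :: "real \<Rightarrow> real ^ 'd \<Rightarrow> real"
  assumes \<eta>_measurable: "case_prod \<eta> \<in> borel_measurable (borel \<Otimes>\<^sub>M borel)"
    and \<eta>_nonneg: "\<And>s y. 0 \<le> \<eta> s y" and \<eta>_le: "\<And>s y. \<eta> s y \<le> \<delta> y"
begin

definition T :: "nat \<Rightarrow> 'w \<Rightarrow> real" where
  "T n \<omega> = fst (em_chain f g \<eta> x\<^sub>0 (\<lambda>s. W s \<omega>) n)"

definition Y :: "nat \<Rightarrow> 'w \<Rightarrow> real ^ 'd" where
  "Y n \<omega> = snd (em_chain f g \<eta> x\<^sub>0 (\<lambda>s. W s \<omega>) n)"

lemma T_0 [simp]: "T 0 \<omega> = 0" and Y_0 [simp]: "Y 0 \<omega> = x\<^sub>0"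
  by (simp_all add: T_def Y_def)

lemma T_Suc: "T (Suc n) \<omega> = T n \<omega> + \<eta> (T n \<omega>) (Y n \<omega>)"
  by (simp add: T_def Y_def Let_def case_prod_beta)

lemma Y_Suc: "Y (Suc n) \<omega> = Y n \<omega> + \<eta> (T n \<omega>) (Y n \<omega>) *\<^sub>R f (Y n \<omega>)
    + g (Y n \<omega>) *v (W (T (Suc n) \<omega>) \<omega> - W (T n \<omega>) \<omega>)"
  by (simp add: T_def Y_def Let_def case_prod_beta)

lemma T_nonneg: "0 \<le> T n \<omega>"
  by (induction n) (simp_all add: T_Suc \<eta>_nonneg)

lemma \<eta>_comp_measurable [measurable (raw)]:
  assumes "a \<in> borel_measurable N" "b \<in> borel_measurable N"
  shows "(\<lambda>x. \<eta> (a x) (b x)) \<in> borel_measurable N"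
  using measurable_compose[OF measurable_Pair[OF assms] \<eta>_measurable] by simp

lemma T_Y_measurable [measurable]: "T n \<in> borel_measurable M" "Y n \<in> borel_measurable M"
proof (induction n)
  case 0
  { case 1 show ?case unfolding T_0 by measurable }
  { case 2 show ?case unfolding Y_0 by measurable }
next
  case (Suc n)
  note IH = Suc.IH
  have H: "(\<lambda>\<omega>. \<eta> (T n \<omega>) (Y n \<omega>)) \<in> borel_measurable M"
    by (rule \<eta>_comp_measurable[OF IH])
  have T: "T (Suc n) \<in> borel_measurable M"
    unfolding T_Suc by (intro borel_measurable_add IH H)
  { case 1 show ?case by (rule T) }
  { case 2 show ?case unfolding Y_Suc
      by (intro borel_measurable_add borel_measurable_diff borel_measurable_scaleR
          borel_measurable_matrix_vector_mult IH H W_at_random_time_measurable T T_nonneg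
          measurable_compose[OF IH(2) f_measurable] measurable_compose[OF IH(2) g_measurable]) }
qed

text \<open>The grid points are stopping times, and the state at such a time belongs to its past. Both facts
are expressed without stopped \<open>\<sigma>\<close>-algebras: at each deterministic time \<open>u\<close> the state is known if
the grid point has already been reached, and is otherwise replaced by a constant. The constant
\<open>u + 1\<close> lets the event \<open>T n \<omega> \<le> u\<close> be read off from the replaced time.\<close>

lemma T_Y_adapted:
  assumes u: "0 \<le> u"
  shows "(\<lambda>\<omega>. if T n \<omega> \<le> u then T n \<omega> else u + 1) \<in> borel_measurable (F u)" (is ?T)
    and "(\<lambda>\<omega>. if T n \<omega> \<le> u then Y n \<omega> else 0) \<in> borel_measurable (F u)" (is ?Y)
proof -
  have "(\<lambda>\<omega>. if T n \<omega> \<le> u then T n \<omega> else u + 1) \<in> borel_measurable (F u) \<and>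
    (\<lambda>\<omega>. if T n \<omega> \<le> u then Y n \<omega> else 0) \<in> borel_measurable (F u)"
  proof (induction n)
    case 0
    then show ?case using u by simp
  next
    case (Suc n)
    define S where "S \<omega> = (if T n \<omega> \<le> u then T n \<omega> else u + 1)" for \<omega>
    define y where "y \<omega> = (if T n \<omega> \<le> u then Y n \<omega> else 0)" for \<omega>
    define S' where "S' \<omega> = S \<omega> + \<eta> (S \<omega>) (y \<omega>)" for \<omega>
    have [measurable]: "S \<in> borel_measurable (F u)" "y \<in> borel_measurable (F u)"
      using Suc.IH unfolding S_def y_def by auto
    have S'm: "S' \<in> borel_measurable (F u)" unfolding S'_def by measurable
    have S0: "0 \<le> S \<omega>" "0 \<le> S' \<omega>" for \<omega>
      using u T_nonneg \<eta>_nonneg by (auto simp: S_def S'_def intro!: add_nonneg_nonneg)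
    have S'u: "S' \<omega> \<le> u \<longleftrightarrow> T (Suc n) \<omega> \<le> u" for \<omega>
      using \<eta>_nonneg[of "T n \<omega>" "Y n \<omega>"] \<eta>_nonneg[of "u + 1" 0]
      by (auto simp: S'_def S_def y_def T_Suc)
    have T': "T n \<omega> \<le> u" "S' \<omega> = T (Suc n) \<omega>" "S \<omega> = T n \<omega>" "y \<omega> = Y n \<omega>"
      if "T (Suc n) \<omega> \<le> u" for \<omega>
      using that \<eta>_nonneg[of "T n \<omega>" "Y n \<omega>"] by (auto simp: S'_def S_def y_def T_Suc)
    note [measurable] = S'm W_at_bounded_time_measurable[OF u S'm S0(2)]
      W_at_bounded_time_measurable[OF u \<open>S \<in> borel_measurable (F u)\<close> S0(1)]
    have "(\<lambda>\<omega>. if T (Suc n) \<omega> \<le> u then T (Suc n) \<omega> else u + 1) = (\<lambda>\<omega>. if S' \<omega> \<le> u then S' \<omega> else u + 1)"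
      using S'u T'(2) by (auto simp: fun_eq_iff)
    moreover have "(\<lambda>\<omega>. if T (Suc n) \<omega> \<le> u then Y (Suc n) \<omega> else 0)
      = (\<lambda>\<omega>. if S' \<omega> \<le> u then y \<omega> + \<eta> (S \<omega>) (y \<omega>) *\<^sub>R f (y \<omega>)
          + g (y \<omega>) *v (W (min (S' \<omega>) u) \<omega> - W (min (S \<omega>) u) \<omega>) else 0)"
      using T' by (auto simp: fun_eq_iff S'u Y_Suc min_absorb1)
    ultimately show ?case by (simp only:) measurable
  qed
  then show ?T ?Y by auto
qed

definition moment :: "nat \<Rightarrow> 'w \<Rightarrow> real" where
  "moment n \<omega> = exp (\<kappa> * T n \<omega>) * norm (Y n \<omega>) powr p"

lemma moment_measurable [measurable]: "moment n \<in> borel_measurable M"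
  unfolding moment_def by measurable

text \<open>This replaces the strong Markov property. The random starting time of the step is rounded up and
its random length rounded down to multiples of \<open>1 / Suc k\<close>. Rounding the time up keeps the state
in the past of the rounded time; rounding the length down keeps the step admissible. On each of
the countably many events on which the rounded values are fixed, the contraction for
deterministic times applies. As \<open>k\<close> grows, path continuity gives pointwise convergence to the
true step, and the bound survives by Fatou's lemma.\<close>

lemma nn_integral_moment_Suc: "(\<integral>\<^sup>+\<omega>. moment (Suc n) \<omega> \<partial>M) \<le> (\<integral>\<^sup>+\<omega>. moment n \<omega> \<partial>M)"
proof -
  define H where "H \<omega> = \<eta> (T n \<omega>) (Y n \<omega>)" for \<omega>
  define j where "j k \<omega> = nat \<lceil>real (Suc k) * T n \<omega>\<rceil>" for k \<omega>
  define i where "i k \<omega> = nat \<lfloor>real (Suc k) * H \<omega>\<rfloor>" for k \<omega>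
  define s where "s k \<omega> = real (j k \<omega>) / real (Suc k)" for k \<omega>
  define h where "h k \<omega> = real (i k \<omega>) / real (Suc k)" for k \<omega>
  define \<Phi> where "\<Phi> k \<omega> = exp (\<kappa> * (T n \<omega> + h k \<omega>)) * norm (Y n \<omega> + h k \<omega> *\<^sub>R f (Y n \<omega>)
      + g (Y n \<omega>) *v (W (s k \<omega> + h k \<omega>) \<omega> - W (s k \<omega>) \<omega>)) powr p" for k \<omega>
  have [measurable]: "H \<in> borel_measurable M" unfolding H_def by measurable
  have H0: "0 \<le> H \<omega>" for \<omega> by (simp add: H_def \<eta>_nonneg)
  have [measurable]: "j k \<in> measurable M (count_space UNIV)"
    "i k \<in> measurable M (count_space UNIV)" for k unfolding j_def i_def by measurable
  have s0: "0 \<le> s k \<omega>" and h0: "0 \<le> h k \<omega>" for k \<omega> by (simp_all add: s_def h_def)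
  have [measurable]: "s k \<in> borel_measurable M" "h k \<in> borel_measurable M" for k
    unfolding s_def h_def by measurable
  have [measurable]: "(\<lambda>\<omega>. W (s k \<omega>) \<omega>) \<in> borel_measurable M"
    "(\<lambda>\<omega>. W (s k \<omega> + h k \<omega>) \<omega>) \<in> borel_measurable M" for k
    by (intro W_at_random_time_measurable, simp_all add: s0 h0)+
  have [measurable]: "\<Phi> k \<in> borel_measurable M" for k unfolding \<Phi>_def by measurable
  have grid: "(\<integral>\<^sup>+\<omega>. \<Phi> k \<omega> \<partial>M) \<le> (\<integral>\<^sup>+\<omega>. moment n \<omega> \<partial>M)" for k
  proof (rule nn_integral_le_by_countable_partition[where c = "\<lambda>\<omega>. (j k \<omega>, i k \<omega>)"])
    fix ab :: "nat \<times> nat"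
    obtain a b where ab: "ab = (a, b)" by (cases ab)
    define m where "m = real (Suc k)"
    define u where "u = real a / m"
    define hh where "hh = real b / m"
    have m: "0 < m" by (simp add: m_def)
    have u0: "0 \<le> u" by (simp add: u_def m_def)
    define S where "S \<omega> = (if T n \<omega> \<le> u then T n \<omega> else u + 1)" for \<omega>
    define y where "y \<omega> = (if T n \<omega> \<le> u then Y n \<omega> else 0)" for \<omega>
    \<comment> \<open>The event of the partition, described by quantities that are known at time \<open>u\<close>.\<close>
    define A where "A \<omega> \<longleftrightarrow> S \<omega> \<le> u \<and> nat \<lceil>m * S \<omega>\<rceil> = a \<and> nat \<lfloor>m * \<eta> (S \<omega>) (y \<omega>)\<rfloor> = b" for \<omega>
    have [measurable]: "S \<in> borel_measurable (F u)" "y \<in> borel_measurable (F u)"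
      using T_Y_adapted[OF u0, of n] unfolding S_def y_def by auto
    have [measurable]: "Measurable.pred (F u) A" unfolding A_def by measurable
    have A_iff: "A \<omega> \<longleftrightarrow> (j k \<omega>, i k \<omega>) = ab" for \<omega>
    proof -
      have "T n \<omega> \<le> u" if "j k \<omega> = a"
      proof -
        have "m * T n \<omega> \<le> real a" using that unfolding j_def m_def by linarith
        then show ?thesis using m by (simp add: u_def field_simps)
      qed
      then show ?thesis by (auto simp: A_def S_def y_def ab j_def i_def H_def m_def)
    qed
    have A_eq: "S \<omega> = T n \<omega>" "y \<omega> = Y n \<omega>" "s k \<omega> = u" "h k \<omega> = hh" if "A \<omega>" for \<omega>
      using that A_iff[of \<omega>] u0
      by (auto simp: A_def S_def y_def s_def h_def ab u_def hh_def m_def split: if_splits)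
    have hh_le: "hh \<le> \<delta> (Y n \<omega>)" if "A \<omega>" for \<omega>
    proof -
      have "real b \<le> m * H \<omega>"
        using that A_iff[of \<omega>] H0[of \<omega>] mult_nonneg_nonneg[of m "H \<omega>"] m
        unfolding ab i_def m_def by auto
      then have "hh \<le> H \<omega>" using m by (simp add: hh_def field_simps)
      then show ?thesis using \<eta>_le[of "T n \<omega>" "Y n \<omega>"] by (simp add: H_def)
    qed
    define V where "V \<omega> = (if A \<omega> then exp (\<kappa> * S \<omega>) else 0)" for \<omega>
    define y' where "y' \<omega> = (if A \<omega> then y \<omega> else 0)" for \<omega>
    have V: "V \<in> borel_measurable (F u)" and y': "y' \<in> borel_measurable (F u)"
      unfolding V_def y'_def by measurable
    have l: "(\<integral>\<^sup>+\<omega>. ennreal (\<Phi> k \<omega>) * indicator {ab} (j k \<omega>, i k \<omega>) \<partial>M)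
        = (\<integral>\<^sup>+\<omega>. ennreal (V \<omega> * (exp (\<kappa> * hh) *
          norm (y' \<omega> + hh *\<^sub>R f (y' \<omega>) + g (y' \<omega>) *v (W (u + hh) \<omega> - W u \<omega>)) powr p)) \<partial>M)"
      by (intro nn_integral_cong)
         (auto simp: indicator_def A_iff[symmetric] V_def y'_def \<Phi>_def A_eq exp_add distrib_left mult.assoc)
    have r: "(\<integral>\<^sup>+\<omega>. ennreal (moment n \<omega>) * indicator {ab} (j k \<omega>, i k \<omega>) \<partial>M)
        = (\<integral>\<^sup>+\<omega>. ennreal (V \<omega> * norm (y' \<omega>) powr p) \<partial>M)"
      by (intro nn_integral_cong)
         (auto simp: indicator_def A_iff[symmetric] V_def y'_def moment_def A_eq)
    show "(\<integral>\<^sup>+\<omega>. ennreal (\<Phi> k \<omega>) * indicator {ab} (j k \<omega>, i k \<omega>) \<partial>M)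
        \<le> (\<integral>\<^sup>+\<omega>. ennreal (moment n \<omega>) * indicator {ab} (j k \<omega>, i k \<omega>) \<partial>M)"
    proof (cases "hh = 0")
      case True
      then show ?thesis unfolding l r by simp
    next
      case False
      then have "0 < hh" using m by (auto simp: hh_def)
      then show ?thesis unfolding l r
        using hh_le by (intro contraction u0 V y') (auto simp: V_def y'_def A_eq)
    qed
  next
    show "(\<lambda>\<omega>. (j k \<omega>, i k \<omega>)) \<in> measurable M (count_space UNIV)"
      by (rule measurable_compose_countable[where f = "\<lambda>a \<omega>. (a, i k \<omega>)" and g = "j k"]) measurable
  qed measurable
  have lim: "(\<lambda>k. ennreal (\<Phi> k \<omega>)) \<longlonglongrightarrow> ennreal (moment (Suc n) \<omega>)" if \<omega>: "\<omega> \<in> space M" for \<omega>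
  proof -
    have sl: "(\<lambda>k. s k \<omega>) \<longlonglongrightarrow> T n \<omega>"
      unfolding s_def j_def by (rule ceiling_grid_tendsto[OF T_nonneg])
    have hl: "(\<lambda>k. h k \<omega>) \<longlonglongrightarrow> H \<omega>"
      unfolding h_def i_def by (rule floor_grid_tendsto[OF H0])
    have W1: "(\<lambda>k. W (s k \<omega>) \<omega>) \<longlonglongrightarrow> W (T n \<omega>) \<omega>"
      using s0 by (intro continuous_on_tendsto_compose[OF W_continuous[OF \<omega>] sl]) (auto simp: T_nonneg)
    have W2: "(\<lambda>k. W (s k \<omega> + h k \<omega>) \<omega>) \<longlonglongrightarrow> W (T n \<omega> + H \<omega>) \<omega>"
      using s0 h0 H0 T_nonneg
      by (intro continuous_on_tendsto_compose[OF W_continuous[OF \<omega>] tendsto_add[OF sl hl]])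
         (auto intro!: always_eventually)
    have lin: "((\<lambda>k. g (Y n \<omega>) *v (W (s k \<omega> + h k \<omega>) \<omega> - W (s k \<omega>) \<omega>)) \<longlongrightarrow>
        g (Y n \<omega>) *v (W (T n \<omega> + H \<omega>) \<omega> - W (T n \<omega>) \<omega>)) sequentially"
      by (intro bounded_linear.tendsto[OF matrix_vector_mul_bounded_linear] tendsto_diff W1 W2)
    have "(\<lambda>k. \<Phi> k \<omega>) \<longlonglongrightarrow> exp (\<kappa> * (T n \<omega> + H \<omega>)) * norm (Y n \<omega> + H \<omega> *\<^sub>R f (Y n \<omega>)
        + g (Y n \<omega>) *v (W (T n \<omega> + H \<omega>) \<omega> - W (T n \<omega>) \<omega>)) powr p"
      unfolding \<Phi>_def using p_pos
      by (intro tendsto_mult tendsto_exp tendsto_powr' tendsto_norm tendsto_add tendsto_const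
          tendsto_scaleR hl lin) auto
    then show ?thesis
      by (intro tendsto_ennrealI) (simp add: moment_def Y_Suc T_Suc H_def)
  qed
  have "(\<integral>\<^sup>+\<omega>. moment (Suc n) \<omega> \<partial>M) = (\<integral>\<^sup>+\<omega>. liminf (\<lambda>k. ennreal (\<Phi> k \<omega>)) \<partial>M)"
    by (intro nn_integral_cong lim_imp_Liminf[symmetric] lim) simp_all
  also have "\<dots> \<le> liminf (\<lambda>k. \<integral>\<^sup>+\<omega>. \<Phi> k \<omega> \<partial>M)"
    by (intro nn_integral_liminf) measurable
  also have "\<dots> \<le> liminf (\<lambda>k. \<integral>\<^sup>+\<omega>. moment n \<omega> \<partial>M)"
    using grid by (intro Liminf_mono always_eventually) auto
  also have "\<dots> = (\<integral>\<^sup>+\<omega>. moment n \<omega> \<partial>M)" by (simp add: Liminf_const)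
  finally show ?thesis .
qed

lemma nn_integral_moment_le: "(\<integral>\<^sup>+\<omega>. moment n \<omega> \<partial>M) \<le> ennreal (norm x\<^sub>0 powr p)"
proof (induction n)
  case 0
  show ?case by (simp add: moment_def emeasure_space_1)
qed (rule order_trans[OF nn_integral_moment_Suc])

end

section \<open>Non-explosion and the moment bound\<close>

lemma aem_time_0 [simp]: "aem_time f g \<delta> x\<^sub>0 w 0 = 0"
  and aem_value_0 [simp]: "aem_value f g \<delta> x\<^sub>0 w 0 = x\<^sub>0"
  and aem_time_Suc: "aem_time f g \<delta> x\<^sub>0 w (Suc n) = aem_time f g \<delta> x\<^sub>0 w n + \<delta> (aem_value f g \<delta> x\<^sub>0 w n)"
  by (simp_all add: aem_time_def aem_value_def Let_def case_prod_beta)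

lemma aem_step_eq_em_chain: "aem_step f g \<delta> x\<^sub>0 w n = em_chain f g (\<lambda>_. \<delta>) x\<^sub>0 w n"
  by (induction n) (simp_all add: Let_def)

lemma em_chain_agrees_Suc:
  assumes "em_chain f g \<eta> x\<^sub>0 w n = aem_step f g \<delta> x\<^sub>0 w n"
    and "\<eta> (aem_time f g \<delta> x\<^sub>0 w n) (aem_value f g \<delta> x\<^sub>0 w n) = \<delta> (aem_value f g \<delta> x\<^sub>0 w n)"
  shows "em_chain f g \<eta> x\<^sub>0 w (Suc n) = aem_step f g \<delta> x\<^sub>0 w (Suc n)"
  using assms by (simp add: aem_time_def aem_value_def Let_def case_prod_beta)

lemma em_chain_frozen:
  assumes "em_chain f g \<eta> x\<^sub>0 w n = (s, y)" "\<eta> s y = 0" "n \<le> m"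
  shows "em_chain f g \<eta> x\<^sub>0 w m = (s, y)"
  using assms(3) by (induction rule: dec_induct) (simp_all add: assms Let_def)

text \<open>The clock stops at time \<open>t\<close>: the last step is shortened so as to end there, and all later ones
have length zero. The chain also stops as soon as it leaves \<open>B\<close>.\<close>

definition stopped_step :: "('a \<Rightarrow> real) \<Rightarrow> real \<Rightarrow> 'a set \<Rightarrow> real \<Rightarrow> 'a \<Rightarrow> real" where
  "stopped_step \<delta> t B s y = (if y \<in> B then min (\<delta> y) (max 0 (t - s)) else 0)"

text \<open>If the stopped chain is in \<open>B\<close> at step \<open>N\<close>, it was in \<open>B\<close> at all earlier steps, since otherwise
it would still sit where it first left \<open>B\<close>. As the grid has not passed \<open>t\<close> either, no step was
shortened.\<close>

lemma stopped_chain_agrees: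
  assumes \<delta>: "\<And>y. 0 < \<delta> y"
    and before: "\<And>n. n \<le> N \<Longrightarrow> aem_time f g \<delta> x\<^sub>0 w n \<le> t"
    and "snd (em_chain f g (stopped_step \<delta> t B) x\<^sub>0 w N) \<in> B" and "n \<le> N"
  shows "em_chain f g (stopped_step \<delta> t B) x\<^sub>0 w n = aem_step f g \<delta> x\<^sub>0 w n"
    and "aem_value f g \<delta> x\<^sub>0 w n \<in> B"
proof -
  let ?e = "em_chain f g (stopped_step \<delta> t B) x\<^sub>0 w"
  have B: "snd (?e k) \<in> B" if "k \<le> N" for k
  proof (rule ccontr)
    assume k: "snd (?e k) \<notin> B"
    obtain s y where e: "?e k = (s, y)" by (cases "?e k")
    have "?e N = (s, y)"
      using k e by (intro em_chain_frozen[OF e _ that]) (simp add: stopped_step_def)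
    then show False using k e assms(3) by simp
  qed
  have eq: "?e k = aem_step f g \<delta> x\<^sub>0 w k" if "k \<le> N" for k
    using that
  proof (induction k)
    case (Suc k)
    then have e: "?e k = aem_step f g \<delta> x\<^sub>0 w k" by simp
    then have "aem_value f g \<delta> x\<^sub>0 w k \<in> B" using B[of k] Suc.prems by (simp add: aem_value_def)
    moreover have "aem_time f g \<delta> x\<^sub>0 w k + \<delta> (aem_value f g \<delta> x\<^sub>0 w k) \<le> t"
      using before[OF Suc.prems] by (simp add: aem_time_Suc)
    ultimately show ?case
      using \<delta>[of "aem_value f g \<delta> x\<^sub>0 w k"] by (intro em_chain_agrees_Suc e) (auto simp: stopped_step_def)
  qed simp
  show "?e n = aem_step f g \<delta> x\<^sub>0 w n" by (rule eq) fact
  then show "aem_value f g \<delta> x\<^sub>0 w n \<in> B" using B[of n] assms(4) by (simp add: aem_value_def)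
qed

text \<open>On a ball the continuous function \<open>\<delta>\<close> has a positive minimum. A path of the scheme that stays in
the ball passes the time \<open>t\<close> after a number of steps that does not depend on the path; this
uniformity is what allows the estimate of its probability at a single step \<open>N\<close>.\<close>

lemma stopped_chain_leaves_ball:
  fixes \<delta> :: "real ^ 'd \<Rightarrow> real" and f :: "real ^ 'd \<Rightarrow> real ^ 'd" and g :: "real ^ 'd \<Rightarrow> real ^ 'm ^ 'd"
  assumes cont: "continuous_on UNIV \<delta>" and \<delta>: "\<And>y. 0 < \<delta> y" and R: "0 \<le> R"
  obtains N where "\<And>w :: real \<Rightarrow> real ^ 'm. (\<And>n. aem_time f g \<delta> x\<^sub>0 w n \<le> t) \<Longrightarrow>
    snd (em_chain f g (stopped_step \<delta> t (cball 0 R)) x\<^sub>0 w N) \<notin> cball 0 R"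
proof -
  have "\<exists>z\<in>cball 0 R. \<forall>y\<in>cball 0 R. \<delta> z \<le> \<delta> y"
    using R continuous_on_subset[OF cont subset_UNIV] by (intro continuous_attains_inf) auto
  then obtain z where z: "\<And>y. y \<in> cball 0 R \<Longrightarrow> \<delta> z \<le> \<delta> y" by blast
  obtain N where N: "t < real N * \<delta> z" using reals_Archimedean3[OF \<delta>] by blast
  have "snd (em_chain f g (stopped_step \<delta> t (cball 0 R)) x\<^sub>0 w N) \<notin> cball 0 R"
    if le: "\<And>n. aem_time f g \<delta> x\<^sub>0 w n \<le> t" for w :: "real \<Rightarrow> real ^ 'm"
  proof
    assume "snd (em_chain f g (stopped_step \<delta> t (cball 0 R)) x\<^sub>0 w N) \<in> cball 0 R"
    note B = stopped_chain_agrees(2)[OF \<delta> le this]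
    have "real k * \<delta> z \<le> aem_time f g \<delta> x\<^sub>0 w k" if "k \<le> N" for k
      using that
    proof (induction k)
      case (Suc k)
      then show ?case using z[OF B[of k]] by (simp add: aem_time_Suc distrib_right)
    qed simp
    from this[of N] N le[of N] show False by simp
  qed
  then show ?thesis using that by blast
qed

text \<open>The shortened last step is the interpolation that defines the continuous-time solution.\<close>

lemma stopped_chain_reaches_solution:
  assumes \<delta>: "\<And>y. 0 < \<delta> y" and t: "0 \<le> t" and ex: "\<exists>n. t < aem_time f g \<delta> x\<^sub>0 w n"
  obtains N where "\<And>n. N \<le> n \<Longrightarrow>
    em_chain f g (stopped_step \<delta> t UNIV) x\<^sub>0 w n = (t, aem_solution f g \<delta> x\<^sub>0 w t)"
proof -
  let ?\<tau> = "aem_time f g \<delta> x\<^sub>0 w" and ?y = "aem_value f g \<delta> x\<^sub>0 w"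
  let ?e = "em_chain f g (stopped_step \<delta> t UNIV) x\<^sub>0 w"
  have mono: "mono ?\<tau>"
    using \<delta> by (intro incseq_SucI) (simp add: aem_time_Suc less_imp_le)
  obtain m where m: "t < ?\<tau> m" using ex by blast
  have "n < m" if "?\<tau> n \<le> t" for n
    using that m monoD[OF mono, of m n] by linarith
  then have "{n. ?\<tau> n \<le> t} \<subseteq> {..<m}" by blast
  then have fin: "finite {n. ?\<tau> n \<le> t}" by (rule finite_subset) simp
  define N where "N = Max {n. ?\<tau> n \<le> t}"
  have "0 \<in> {n. ?\<tau> n \<le> t}" using t by simp
  then have "N \<in> {n. ?\<tau> n \<le> t}" unfolding N_def by (intro Max_in[OF fin]) blast
  then have N: "?\<tau> N \<le> t" by blast
  have N': "t < ?\<tau> (Suc N)"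
  proof (rule ccontr)
    assume "\<not> t < ?\<tau> (Suc N)"
    then have "Suc N \<le> Max {n. ?\<tau> n \<le> t}" by (intro Max_ge fin) simp
    then have "Suc N \<le> N" by (simp add: N_def)
    then show False by simp
  qed
  have "?e N = aem_step f g \<delta> x\<^sub>0 w N"
  proof (rule stopped_chain_agrees(1)[OF \<delta>])
    show "?\<tau> k \<le> t" if "k \<le> N" for k using order_trans[OF monoD[OF mono that] N] .
  qed simp_all
  then have e: "?e N = (?\<tau> N, ?y N)" by (simp add: aem_time_def aem_value_def)
  have "stopped_step \<delta> t UNIV (?\<tau> N) (?y N) = t - ?\<tau> N"
    using N N' by (simp add: stopped_step_def aem_time_Suc)
  then have reached: "?e (Suc N) = (t, aem_solution f g \<delta> x\<^sub>0 w t)"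
    by (simp add: e Let_def aem_solution_def N_def[symmetric])
  have "stopped_step \<delta> t UNIV t y = 0" for y
    using \<delta>[of y] by (simp add: stopped_step_def)
  then have "?e n = (t, aem_solution f g \<delta> x\<^sub>0 w t)" if "Suc N \<le> n" for n
    by (rule em_chain_frozen[OF reached _ that])
  then show ?thesis using that by blast
qed

text \<open>Markov's inequality. For a chain that stops on leaving the ball it serves as a maximal
inequality, because such a chain is outside at step \<open>n\<close> if it was outside at any earlier step.\<close>

lemma (in contracting_chain) emeasure_Y_outside_ball:
  assumes R: "0 < R"
  shows "emeasure M {\<omega> \<in> space M. R < norm (Y n \<omega>)} \<le> ennreal ((norm x\<^sub>0 / R) powr p)"
proof -
  have "emeasure M {\<omega> \<in> space M. R < norm (Y n \<omega>)}
      = (\<integral>\<^sup>+\<omega>. indicator {\<omega> \<in> space M. R < norm (Y n \<omega>)} \<omega> \<partial>M)"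
    by (intro nn_integral_indicator[symmetric]) measurable
  also have "\<dots> \<le> (\<integral>\<^sup>+\<omega>. ennreal (1 / R powr p) * ennreal (moment n \<omega>) \<partial>M)"
  proof (intro nn_integral_mono)
    fix \<omega>
    have "1 \<le> 1 / R powr p * moment n \<omega>" if "R < norm (Y n \<omega>)"
    proof -
      have "R powr p \<le> norm (Y n \<omega>) powr p" using that R p_pos by (intro powr_mono2) auto
      also have "\<dots> \<le> moment n \<omega>"
        using \<kappa>_nonneg T_nonneg[of n \<omega>] by (simp add: moment_def mult_le_cancel_right1)
      finally show ?thesis using R by (simp add: field_simps)
    qed
    then show "indicator {\<omega> \<in> space M. R < norm (Y n \<omega>)} \<omega> \<le> ennreal (1 / R powr p) * ennreal (moment n \<omega>)"
      by (auto simp: indicator_def ennreal_mult'[symmetric] not_le simp flip: ennreal_1 intro!: ennreal_leI)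
  qed
  also have "\<dots> = ennreal (1 / R powr p) * (\<integral>\<^sup>+\<omega>. ennreal (moment n \<omega>) \<partial>M)"
    by (rule nn_integral_cmult) measurable
  also have "\<dots> \<le> ennreal (1 / R powr p) * ennreal (norm x\<^sub>0 powr p)"
    by (intro mult_left_mono nn_integral_moment_le) simp
  also have "\<dots> = ennreal ((norm x\<^sub>0 / R) powr p)"
    using R by (simp add: ennreal_mult'[symmetric] powr_divide)
  finally show ?thesis .
qed

context contracting_scheme begin

lemma contracting_chain_stopped:
  assumes [measurable]: "B \<in> sets borel"
  shows "contracting_chain M F W f g \<delta> p \<kappa> (stopped_step \<delta> t B)"
proof unfold_locales
  show "case_prod (stopped_step \<delta> t B) \<in> borel_measurable (borel \<Otimes>\<^sub>M borel)"
    unfolding stopped_step_def by measurable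
  show "0 \<le> stopped_step \<delta> t B s y" "stopped_step \<delta> t B s y \<le> \<delta> y" for s y
    using \<delta>_pos[of y] by (auto simp: stopped_step_def)
qed

lemma contracting_chain_unstopped: "contracting_chain M F W f g \<delta> p \<kappa> (\<lambda>_. \<delta>)"
  using \<delta>_pos by unfold_locales (auto simp: less_imp_le)

lemma aem_time_measurable [measurable]: "(\<lambda>\<omega>. aem_time f g \<delta> x\<^sub>0 (\<lambda>s. W s \<omega>) n) \<in> borel_measurable M"
proof -
  interpret C: contracting_chain M F W f g \<delta> p \<kappa> x\<^sub>0 "\<lambda>_. \<delta>" by (rule contracting_chain_unstopped)
  have "C.T n = (\<lambda>\<omega>. aem_time f g \<delta> x\<^sub>0 (\<lambda>s. W s \<omega>) n)"
    by (simp add: fun_eq_iff C.T_def aem_time_def aem_step_eq_em_chain)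
  then show ?thesis using C.T_Y_measurable(1)[of n] by simp
qed

text \<open>If the grid points never pass \<open>t\<close>, the scheme leaves every ball. For a ball of radius \<open>R\<close> this
has probability at most \<open>(norm x\<^sub>0 / R) powr p\<close>, which tends to zero.\<close>

lemma AE_aem_time_unbounded: "AE \<omega> in M. \<exists>n. t < aem_time f g \<delta> x\<^sub>0 (\<lambda>s. W s \<omega>) n"
proof -
  define bad where "bad = {\<omega> \<in> space M. \<forall>n. aem_time f g \<delta> x\<^sub>0 (\<lambda>s. W s \<omega>) n \<le> t}"
  have [measurable]: "bad \<in> sets M" unfolding bad_def by measurable
  have le: "emeasure M bad \<le> ennreal ((norm x\<^sub>0 / R) powr p)" if R: "0 < R" for R
  proof -
    interpret C: contracting_chain M F W f g \<delta> p \<kappa> x\<^sub>0 "stopped_step \<delta> t (cball 0 R)"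
      by (rule contracting_chain_stopped) simp
    obtain N where N: "\<And>w. (\<And>n. aem_time f g \<delta> x\<^sub>0 w n \<le> t) \<Longrightarrow>
        snd (em_chain f g (stopped_step \<delta> t (cball 0 R)) x\<^sub>0 w N) \<notin> cball 0 R"
      using stopped_chain_leaves_ball[OF \<delta>_continuous \<delta>_pos, of R f g x\<^sub>0 t] R by auto
    have "emeasure M bad \<le> emeasure M {\<omega> \<in> space M. R < norm (C.Y N \<omega>)}"
    proof (rule emeasure_mono)
      show "bad \<subseteq> {\<omega> \<in> space M. R < norm (C.Y N \<omega>)}"
        using N by (auto simp: bad_def C.Y_def not_le)
    qed measurable
    also have "\<dots> \<le> ennreal ((norm x\<^sub>0 / R) powr p)" by (rule C.emeasure_Y_outside_ball[OF R])
    finally show ?thesis .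
  qed
  have "(\<lambda>k. (norm x\<^sub>0 / real (Suc k)) powr p) \<longlonglongrightarrow> 0 powr p"
    using p_pos tendsto_mult_right_zero[OF LIMSEQ_inverse_real_of_nat, of "norm x\<^sub>0"]
    by (intro tendsto_powr') (auto simp: divide_inverse intro!: always_eventually)
  then have "(\<lambda>k. ennreal ((norm x\<^sub>0 / real (Suc k)) powr p)) \<longlonglongrightarrow> ennreal 0"
    by (intro tendsto_ennrealI) simp
  then have "emeasure M bad \<le> ennreal 0"
    by (rule LIMSEQ_le_const) (use le in auto)
  then have "bad \<in> null_sets M" by (auto simp: null_sets_def)
  from AE_not_in[OF this] AE_space show ?thesis
    by eventually_elim (auto simp: bad_def not_le)
qed

text \<open>Almost surely the chain stopped at \<open>t\<close> is eventually equal to the solution at time \<open>t\<close>, so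
Fatou's lemma passes the uniform moment bound on to the solution. The latter is meaningless
where the grid points never pass \<open>t\<close>; the random variable \<open>S\<close> is a measurable version of it.\<close>

lemma aem_solution_moment:
  assumes t: "0 \<le> t"
  obtains S where "S \<in> borel_measurable M"
    and "AE \<omega> in M. aem_solution f g \<delta> x\<^sub>0 (\<lambda>s. W s \<omega>) t = S \<omega>"
    and "(\<integral>\<^sup>+\<omega>. ennreal (norm (S \<omega>) powr p) \<partial>M) \<le> ennreal (norm x\<^sub>0 powr p * exp (- \<kappa> * t))"
proof -
  interpret C: contracting_chain M F W f g \<delta> p \<kappa> x\<^sub>0 "stopped_step \<delta> t UNIV"
    by (rule contracting_chain_stopped) simp
  define good where "good \<omega> \<longleftrightarrow> (\<exists>n. t < aem_time f g \<delta> x\<^sub>0 (\<lambda>s. W s \<omega>) n)" for \<omega>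
  define S where "S \<omega> = (if good \<omega> then aem_solution f g \<delta> x\<^sub>0 (\<lambda>s. W s \<omega>) t else 0)" for \<omega>
  have [measurable]: "Measurable.pred M good" unfolding good_def by measurable
  have ev: "\<forall>\<^sub>F n in sequentially. C.T n \<omega> = t \<and> C.Y n \<omega> = S \<omega>" if "good \<omega>" for \<omega>
  proof -
    obtain N where "\<And>n. N \<le> n \<Longrightarrow> em_chain f g (stopped_step \<delta> t UNIV) x\<^sub>0 (\<lambda>s. W s \<omega>) n
        = (t, aem_solution f g \<delta> x\<^sub>0 (\<lambda>s. W s \<omega>) t)"
      by (rule stopped_chain_reaches_solution[OF \<delta>_pos t \<open>good \<omega>\<close>[unfolded good_def]]) (blast intro: that)
    then show ?thesis using that by (auto simp: C.T_def C.Y_def S_def eventually_sequentially intro!: exI[of _ N])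
  qed
  have S: "S \<in> borel_measurable M"
  proof (rule borel_measurable_LIMSEQ_metric)
    show "(\<lambda>\<omega>. if good \<omega> then C.Y n \<omega> else 0) \<in> borel_measurable M" for n by measurable
    show "(\<lambda>n. if good \<omega> then C.Y n \<omega> else 0) \<longlonglongrightarrow> S \<omega>" for \<omega>
      using ev[of \<omega>] by (cases "good \<omega>") (auto simp: S_def intro!: tendsto_eventually elim: eventually_mono)
  qed
  have AE_good: "AE \<omega> in M. good \<omega>" unfolding good_def by (rule AE_aem_time_unbounded)
  have "(\<integral>\<^sup>+\<omega>. ennreal (exp (\<kappa> * t) * norm (S \<omega>) powr p) \<partial>M)
      = (\<integral>\<^sup>+\<omega>. liminf (\<lambda>n. ennreal (C.moment n \<omega>)) \<partial>M)"
  proof (rule nn_integral_cong_AE, use AE_good in eventually_elim)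
    case (elim \<omega>)
    have "(\<lambda>n. ennreal (C.moment n \<omega>)) \<longlonglongrightarrow> ennreal (exp (\<kappa> * t) * norm (S \<omega>) powr p)"
      using ev[OF elim] by (intro tendsto_eventually) (auto elim!: eventually_mono simp: C.moment_def)
    then show ?case by (intro lim_imp_Liminf[symmetric]) simp_all
  qed
  also have "\<dots> \<le> liminf (\<lambda>n. \<integral>\<^sup>+\<omega>. C.moment n \<omega> \<partial>M)"
    by (intro nn_integral_liminf) measurable
  also have "\<dots> \<le> liminf (\<lambda>n. ennreal (norm x\<^sub>0 powr p))"
    by (intro Liminf_mono always_eventually allI C.nn_integral_moment_le)
  finally have le: "(\<integral>\<^sup>+\<omega>. ennreal (exp (\<kappa> * t) * norm (S \<omega>) powr p) \<partial>M) \<le> ennreal (norm x\<^sub>0 powr p)"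
    by (simp add: Liminf_const)
  have "(\<integral>\<^sup>+\<omega>. ennreal (norm (S \<omega>) powr p) \<partial>M)
      = (\<integral>\<^sup>+\<omega>. ennreal (exp (- \<kappa> * t)) * ennreal (exp (\<kappa> * t) * norm (S \<omega>) powr p) \<partial>M)"
    by (intro nn_integral_cong) (simp add: ennreal_mult'[symmetric] mult.assoc[symmetric] exp_add[symmetric])
  also have "\<dots> = ennreal (exp (- \<kappa> * t)) * (\<integral>\<^sup>+\<omega>. ennreal (exp (\<kappa> * t) * norm (S \<omega>) powr p) \<partial>M)"
    using S by (intro nn_integral_cmult) measurable
  also have "\<dots> \<le> ennreal (exp (- \<kappa> * t)) * ennreal (norm x\<^sub>0 powr p)"
    by (intro mult_left_mono le) simp
  also have "\<dots> = ennreal (norm x\<^sub>0 powr p * exp (- \<kappa> * t))"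
    by (simp add: ennreal_mult'[symmetric] mult.commute)
  finally have "(\<integral>\<^sup>+\<omega>. ennreal (norm (S \<omega>) powr p) \<partial>M) \<le> ennreal (norm x\<^sub>0 powr p * exp (- \<kappa> * t))" .
  moreover have "AE \<omega> in M. aem_solution f g \<delta> x\<^sub>0 (\<lambda>s. W s \<omega>) t = S \<omega>"
    using AE_good by eventually_elim (simp add: S_def)
  ultimately show ?thesis using that S by blast
qed

end

section \<open>Exponential decay of moments\<close>

lemma continuous_on_UNIV_if_locally_Lipschitz:
  fixes f :: "'a :: real_normed_vector \<Rightarrow> 'b :: real_normed_vector"
  assumes "\<And>R. 0 < R \<Longrightarrow> \<exists>C>0. \<forall>x y. max (norm x) (norm y) \<le> R \<longrightarrow> norm (f x - f y) \<le> C * norm (x - y)"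
  shows "continuous_on UNIV f"
proof (rule continuous_at_imp_continuous_on, rule ballI)
  fix x :: 'a
  obtain C where C: "0 < C" "\<And>y z. max (norm y) (norm z) \<le> norm x + 1 \<Longrightarrow> norm (f y - f z) \<le> C * norm (y - z)"
    using assms[of "norm x + 1"] by (auto simp: add_nonneg_pos)
  have "C-lipschitz_on (ball 0 (norm x + 1)) f"
    using C by (intro lipschitz_onI) (auto simp: dist_norm)
  then have "continuous_on (ball 0 (norm x + 1)) f" by (rule lipschitz_on_continuous_on)
  then show "isCont f x" by (rule continuous_on_interior) simp
qed

text \<open>This makes the solution measurable although its value is unspecified on the null event where the
grid does not pass \<open>t\<close>.\<close>

lemma (in complete_measure) measurable_if_AE_eq:
  assumes S: "S \<in> measurable M N" and eq: "AE x in M. h x = S x"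
    and sp: "\<And>x. x \<in> space M \<Longrightarrow> h x \<in> space N"
  shows "h \<in> measurable M N"
proof (rule measurableI)
  obtain Z where Z: "Z \<in> null_sets M" "{x \<in> space M. h x \<noteq> S x} \<subseteq> Z"
    using AE_E[OF eq] by (metis null_setsI)
  fix B assume B: "B \<in> sets N"
  have "h -` B \<inter> space M = ((S -` B \<inter> space M) - Z) \<union> (h -` B \<inter> space M \<inter> Z)" using Z(2) by auto
  moreover have "h -` B \<inter> space M \<inter> Z \<in> sets M"
    using complete2[OF _ Z(1), of "h -` B \<inter> space M \<inter> Z"] by auto
  ultimately show "h -` B \<inter> space M \<in> sets M" using measurable_sets[OF S B] Z(1) by (metis sets.Un sets.Diff null_setsD2)
qed (rule sp)

theorem theorem7p5:
  fixes M :: "'w measure"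
    and F :: "real \<Rightarrow> 'w measure"
    and W :: "real \<Rightarrow> 'w \<Rightarrow> real ^ 'm"
    and f :: "real ^ 'd \<Rightarrow> real ^ 'd"
    and g :: "real ^ 'd \<Rightarrow> real ^ 'm ^ 'd"
    and x\<^sub>0 :: "real ^ 'd"
    and p \<nu> \<gamma> :: real
  assumes BM: "brownian_motion M F W"
    and local_Lipschitz: "\<forall>R>0. \<exists>C>0. \<forall>x y. max (norm x) (norm y) \<le> R \<longrightarrow>
      norm (f x - f y) + norm (g x - g y) \<le> C * norm (x - y)"
    and "p \<ge> 2" and "\<nu> > 0"
    and dissipative: "\<forall>x. x \<bullet> f x + (p - 1) / 2 * (norm (g x))\<^sup>2 \<le> - \<nu> * (norm x)\<^sup>2"
    and "\<gamma> \<in> {0<..<1/2}"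
  shows "\<forall>\<epsilon>\<in>{0<..<p * \<nu>}. \<exists>\<delta>s>0. \<forall>\<delta>max\<in>{0<..\<delta>s}. \<forall>\<delta> :: real ^ 'd \<Rightarrow> real.
    continuous_on UNIV \<delta> \<and> range \<delta> \<subseteq> {0<..\<delta>max} \<and>
    (\<forall>x. norm (f x) * \<delta> x powr \<gamma> \<le> norm x \<and> (norm (g x))\<^sup>2 * \<delta> x powr \<gamma> \<le> (norm x)\<^sup>2) \<longrightarrow>
    (\<forall>t\<ge>0.
      (AE \<omega> in M. \<exists>n. t < aem_time f g \<delta> x\<^sub>0 (\<lambda>s. W s \<omega>) n) \<and>
      integrable M (\<lambda>\<omega>. norm (aem_solution f g \<delta> x\<^sub>0 (\<lambda>s. W s \<omega>) t) powr p) \<and>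
      prob_space.expectation M (\<lambda>\<omega>. norm (aem_solution f g \<delta> x\<^sub>0 (\<lambda>s. W s \<omega>) t) powr p)
        \<le> norm x\<^sub>0 powr p * exp (- (p * \<nu> - \<epsilon>) * t))"
proof (rule ballI)
  fix \<epsilon> assume \<epsilon>: "\<epsilon> \<in> {0<..<p * \<nu>}"
  interpret brownian_motion M F W by (rule BM)
  define \<kappa> where "\<kappa> = p * \<nu> - \<epsilon>"
  have \<gamma>: "0 < \<gamma>" "\<gamma> < 1/2" using \<open>\<gamma> \<in> {0<..<1/2}\<close> by auto
  let ?Z = "\<lambda>\<omega>. W 1 \<omega> - W 0 \<omega>"
  have Z: "centred_normal_vec 1 ?Z"
    using centred_normal_vec_increment[of 0 1] by simp
  obtain \<delta>s where \<delta>s: "0 < \<delta>s"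
    and step: "\<And>h x v (A :: real ^ 'm ^ 'd). \<lbrakk>0 < h; h \<le> \<delta>s; norm v * h powr \<gamma> \<le> norm x;
        (norm A)\<^sup>2 * h powr \<gamma> \<le> (norm x)\<^sup>2; x \<bullet> v + (p - 1) / 2 * (norm A)\<^sup>2 \<le> - \<nu> * (norm x)\<^sup>2\<rbrakk> \<Longrightarrow>
      (\<integral>\<^sup>+\<omega>. norm (x + h *\<^sub>R v + A *v (sqrt h *\<^sub>R ?Z \<omega>)) powr p \<partial>M)
        \<le> ennreal (exp (- \<kappa> * h) * norm x powr p)"
    using normal_step_contraction[OF Z \<open>2 \<le> p\<close> \<gamma>, of \<epsilon> \<nu>] \<epsilon> unfolding \<kappa>_def by auto
  have f_cont: "continuous_on UNIV f" and g_cont: "continuous_on UNIV g"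
    by (rule continuous_on_UNIV_if_locally_Lipschitz,
        meson local_Lipschitz add_increasing add_increasing2 norm_ge_zero order_trans order_refl
          le_add_same_cancel1 le_add_same_cancel2)+
  obtain E where E: "E \<in> null_sets M" and cont: "\<And>\<omega>. \<omega> \<in> space M - E \<Longrightarrow> continuous_on {0..} (\<lambda>t. W t \<omega>)"
    using AE_E3[OF continuous_paths] by blast
  \<comment> \<open>The null set \<open>E\<close> belongs to the \<open>\<sigma>\<close>-algebra at time 0, so switching the noise off there keeps it adapted.\<close>
  define W' where "W' t \<omega> = (if \<omega> \<in> E then 0 else W t \<omega>)" for t \<omega>
  have W'_eq: "AE \<omega> in M. (\<lambda>s. W' s \<omega>) = (\<lambda>s. W s \<omega>)"
    using AE_not_in[OF E] by eventually_elim (simp add: W'_def)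
  show "\<exists>\<delta>s>0. \<forall>\<delta>max\<in>{0<..\<delta>s}. \<forall>\<delta> :: real ^ 'd \<Rightarrow> real.
    continuous_on UNIV \<delta> \<and> range \<delta> \<subseteq> {0<..\<delta>max} \<and>
    (\<forall>x. norm (f x) * \<delta> x powr \<gamma> \<le> norm x \<and> (norm (g x))\<^sup>2 * \<delta> x powr \<gamma> \<le> (norm x)\<^sup>2) \<longrightarrow>
    (\<forall>t\<ge>0.
      (AE \<omega> in M. \<exists>n. t < aem_time f g \<delta> x\<^sub>0 (\<lambda>s. W s \<omega>) n) \<and>
      integrable M (\<lambda>\<omega>. norm (aem_solution f g \<delta> x\<^sub>0 (\<lambda>s. W s \<omega>) t) powr p) \<and>
      prob_space.expectation M (\<lambda>\<omega>. norm (aem_solution f g \<delta> x\<^sub>0 (\<lambda>s. W s \<omega>) t) powr p)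
        \<le> norm x\<^sub>0 powr p * exp (- (p * \<nu> - \<epsilon>) * t))"
  proof (intro exI[of _ \<delta>s] conjI ballI allI impI \<delta>s)
    fix \<delta>max t :: real and \<delta> :: "real ^ 'd \<Rightarrow> real"
    assume \<delta>max: "\<delta>max \<in> {0<..\<delta>s}"
      and *: "continuous_on UNIV \<delta> \<and> range \<delta> \<subseteq> {0<..\<delta>max} \<and>
        (\<forall>x. norm (f x) * \<delta> x powr \<gamma> \<le> norm x \<and> (norm (g x))\<^sup>2 * \<delta> x powr \<gamma> \<le> (norm x)\<^sup>2)"
      and t: "0 \<le> t"
    have \<delta>_pos: "0 < \<delta> y" and \<delta>_le: "\<delta> y \<le> \<delta>s" for y
      using * \<delta>max by (auto simp: image_subset_iff intro: order_trans)
    have fb: "norm (f y) * \<delta> y powr \<gamma> \<le> norm y" and gb: "(norm (g y))\<^sup>2 * \<delta> y powr \<gamma> \<le> (norm y)\<^sup>2" for y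
      using * by auto
    have "f 0 = 0" "g 0 = 0"
      using fb[of 0] gb[of 0] \<delta>_pos[of 0] by (simp_all add: mult_le_0_iff)
    \<comment> \<open>At \<open>y = 0\<close> the length may exceed \<open>\<delta>s\<close>, but the coefficients vanish there and the step stays at \<open>0\<close>.\<close>
    have one_step: "(\<integral>\<^sup>+\<omega>. norm (y + h *\<^sub>R f y + g y *v (sqrt h *\<^sub>R ?Z \<omega>)) powr p \<partial>M)
        \<le> ennreal (exp (- \<kappa> * h) * norm y powr p)" if h: "0 < h" "y = 0 \<or> h \<le> \<delta> y" for y h
    proof (cases "y = 0")
      case True
      then show ?thesis using \<open>f 0 = 0\<close> \<open>g 0 = 0\<close> by simp
    next
      case False
      then have "h powr \<gamma> \<le> \<delta> y powr \<gamma>" using h \<gamma> by (intro powr_mono2) auto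
      then have "norm (f y) * h powr \<gamma> \<le> norm y" "(norm (g y))\<^sup>2 * h powr \<gamma> \<le> (norm y)\<^sup>2"
        using fb[of y] gb[of y] by (meson mult_left_mono norm_ge_zero zero_le_power2 order_trans)+
      then show ?thesis
        using False h \<delta>_le[of y] dissipative by (intro step) auto
    qed
    interpret contracting_scheme M F W' f g \<delta> p \<kappa> x\<^sub>0
    proof unfold_locales
      show "subalgebra M (F t)" if "0 \<le> t" for t by (rule filtration_subalgebra[OF that])
      show "subalgebra (F t) (F s)" if "0 \<le> s" "s \<le> t" for s t by (rule filtration_mono[OF that])
      show "W' t \<in> borel_measurable (F t)" if "0 \<le> t" for t
      proof -
        have [measurable]: "E \<in> sets (F t)"
          using E filtration_null_sets filtration_mono[of 0 t] that by (auto simp: subalgebra_def)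
        have [measurable]: "W t \<in> borel_measurable (F t)" by (rule adapted[OF that])
        show ?thesis unfolding W'_def by measurable
      qed
      show "continuous_on {0..} (\<lambda>t. W' t \<omega>)" if "\<omega> \<in> space M" for \<omega>
        using cont[of \<omega>] that by (cases "\<omega> \<in> E") (simp_all add: W'_def)
      show "continuous_on UNIV \<delta>" using * by blast
      show "0 < p" "0 \<le> \<kappa>" using \<open>2 \<le> p\<close> \<epsilon> by (auto simp: \<kappa>_def)
    next
      fix s h :: real and V :: "'w \<Rightarrow> real" and Y :: "'w \<Rightarrow> real ^ 'd"
      assume s: "0 \<le> s" "0 < h" and V: "V \<in> borel_measurable (F s)" "\<And>\<omega>. 0 \<le> V \<omega>"
        and Y: "Y \<in> borel_measurable (F s)" "\<And>\<omega>. Y \<omega> = 0 \<or> h \<le> \<delta> (Y \<omega>)"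
      define \<phi> :: "(real \<times> (real ^ 'd)) \<times> (real ^ 'm) \<Rightarrow> ennreal" where
        "\<phi> x = ennreal (fst (fst x) * (exp (\<kappa> * h) *
          norm (snd (fst x) + h *\<^sub>R f (snd (fst x)) + g (snd (fst x)) *v snd x) powr p))" for x
      have [measurable]: "f \<in> borel_measurable borel" "g \<in> borel_measurable borel"
        by (rule borel_measurable_continuous_onI[OF f_cont], rule borel_measurable_continuous_onI[OF g_cont])
      have \<phi>: "\<phi> \<in> borel_measurable ((borel \<Otimes>\<^sub>M borel) \<Otimes>\<^sub>M borel)"
        unfolding \<phi>_def by measurable
      have [measurable]: "?Z \<in> borel_measurable M" by (rule centred_normal_vec_measurable[OF Z])
      have "(\<integral>\<^sup>+\<omega>. ennreal (V \<omega> * (exp (\<kappa> * h) *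
          norm (Y \<omega> + h *\<^sub>R f (Y \<omega>) + g (Y \<omega>) *v (W' (s + h) \<omega> - W' s \<omega>)) powr p)) \<partial>M)
          = (\<integral>\<^sup>+\<omega>. \<phi> ((V \<omega>, Y \<omega>), W (s + h) \<omega> - W s \<omega>) \<partial>M)"
        by (rule nn_integral_cong_AE, use W'_eq in eventually_elim) (simp add: \<phi>_def fun_eq_iff)
      also have "\<dots> = (\<integral>\<^sup>+\<omega>. \<integral>\<^sup>+\<omega>'. \<phi> ((V \<omega>, Y \<omega>), sqrt h *\<^sub>R ?Z \<omega>') \<partial>M \<partial>M)"
        by (rule nn_integral_increment_after[OF s measurable_Pair[OF V(1) Y(1)] \<phi>])
      also have "\<dots> \<le> (\<integral>\<^sup>+\<omega>. ennreal (V \<omega> * norm (Y \<omega>) powr p) \<partial>M)"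
      proof (rule nn_integral_mono)
        fix \<omega>
        have "(\<integral>\<^sup>+\<omega>'. \<phi> ((V \<omega>, Y \<omega>), sqrt h *\<^sub>R ?Z \<omega>') \<partial>M)
            = (\<integral>\<^sup>+\<omega>'. ennreal (V \<omega> * exp (\<kappa> * h)) *
                ennreal (norm (Y \<omega> + h *\<^sub>R f (Y \<omega>) + g (Y \<omega>) *v (sqrt h *\<^sub>R ?Z \<omega>')) powr p) \<partial>M)"
          using V(2) by (intro nn_integral_cong) (simp add: \<phi>_def ennreal_mult'[symmetric] mult.assoc)
        also have "\<dots> = ennreal (V \<omega> * exp (\<kappa> * h)) *
            (\<integral>\<^sup>+\<omega>'. norm (Y \<omega> + h *\<^sub>R f (Y \<omega>) + g (Y \<omega>) *v (sqrt h *\<^sub>R ?Z \<omega>')) powr p \<partial>M)"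
          by (rule nn_integral_cmult) measurable
        also have "\<dots> \<le> ennreal (V \<omega> * exp (\<kappa> * h)) * ennreal (exp (- \<kappa> * h) * norm (Y \<omega>) powr p)"
          using s Y(2) by (intro mult_left_mono one_step) auto
        also have "\<dots> = ennreal (V \<omega> * norm (Y \<omega>) powr p)"
        proof -
          have "(V \<omega> * exp (\<kappa> * h)) * (exp (- \<kappa> * h) * norm (Y \<omega>) powr p)
              = V \<omega> * norm (Y \<omega>) powr p * (exp (\<kappa> * h) * exp (- \<kappa> * h))" by simp
          also have "exp (\<kappa> * h) * exp (- \<kappa> * h) = 1" by (simp flip: exp_add)
          finally show ?thesis using V(2)[of \<omega>] by (simp add: ennreal_mult'[symmetric])
        qed
        finally show "(\<integral>\<^sup>+\<omega>'. \<phi> ((V \<omega>, Y \<omega>), sqrt h *\<^sub>R ?Z \<omega>') \<partial>M) \<le> ennreal (V \<omega> * norm (Y \<omega>) powr p)" .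
      qed
      finally show "(\<integral>\<^sup>+\<omega>. ennreal (V \<omega> * (exp (\<kappa> * h) *
          norm (Y \<omega> + h *\<^sub>R f (Y \<omega>) + g (Y \<omega>) *v (W' (s + h) \<omega> - W' s \<omega>)) powr p)) \<partial>M)
        \<le> (\<integral>\<^sup>+\<omega>. ennreal (V \<omega> * norm (Y \<omega>) powr p) \<partial>M)" .
    qed (rule f_cont g_cont \<delta>_pos)+
    let ?X = "\<lambda>\<omega>. aem_solution f g \<delta> x\<^sub>0 (\<lambda>s. W s \<omega>) t"
    show "AE \<omega> in M. \<exists>n. t < aem_time f g \<delta> x\<^sub>0 (\<lambda>s. W s \<omega>) n"
      using AE_aem_time_unbounded[of t] W'_eq by eventually_elim simp
    obtain S where S: "S \<in> borel_measurable M"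
      and "AE \<omega> in M. aem_solution f g \<delta> x\<^sub>0 (\<lambda>s. W' s \<omega>) t = S \<omega>"
      and S_le: "(\<integral>\<^sup>+\<omega>. ennreal (norm (S \<omega>) powr p) \<partial>M) \<le> ennreal (norm x\<^sub>0 powr p * exp (- \<kappa> * t))"
      by (rule aem_solution_moment[OF t])
    then have XS: "AE \<omega> in M. ?X \<omega> = S \<omega>" using W'_eq by (auto elim: eventually_elim2)
    have [measurable]: "?X \<in> borel_measurable M"
      by (rule measurable_if_AE_eq[OF S XS]) simp
    have "(\<integral>\<^sup>+\<omega>. ennreal (norm (?X \<omega>) powr p) \<partial>M) = (\<integral>\<^sup>+\<omega>. ennreal (norm (S \<omega>) powr p) \<partial>M)"
      by (rule nn_integral_cong_AE, use XS in eventually_elim) simp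
    with S_le have le: "(\<integral>\<^sup>+\<omega>. ennreal (norm (?X \<omega>) powr p) \<partial>M) \<le> ennreal (norm x\<^sub>0 powr p * exp (- \<kappa> * t))" by simp
    then show "integrable M (\<lambda>\<omega>. norm (?X \<omega>) powr p)"
      by (intro integrableI_bounded) (auto intro: le_less_trans)
    show "expectation (\<lambda>\<omega>. norm (?X \<omega>) powr p) \<le> norm x\<^sub>0 powr p * exp (- (p * \<nu> - \<epsilon>) * t)"
      using le by (subst integral_eq_nn_integral) (auto intro: enn2real_leI simp: \<kappa>_def)
  qed
qed

end
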